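(* Let $S$ be a semitopological semigroup such that $LUC(S)$ has a left invariant mean. Then $S$ has the following fixed point property $(G^* )$: for every locally convex space $X$ whose topology is determined by a family $Q$ of continuous seminorms and every nonempty weakly compact convex subset $K$ of $X$, every $Q$-nonexpansive and continuous dynamical system $(S,(K,\mathrm{weak}))$ has a fixed point.
   Context: A semitopological semigroup is a (nonempty) semigroup $S$ with a Hausdorff topology such that for each $t\in S$ the maps $s\mapsto ts$ and $s\mapsto st$ are continuous. $\ell^\infty(S)$ is the Banach space of bounded complex-valued functions on $S$ with the supremum norm; for $s\in S$, $L_sf(t)=f(st)$ and $R_sf(t)=f(ts)$. $C(S)$ is the closed subalgebra of bounded continuous functions. $LUC(S)$ is the space of $f\in C(S)$ for which $s\mapsto L_sf$ is continuous from $S$ to $C(S)$ with the norm topology. If $Y$ is a closed linear subspace of $\ell^\infty(S)$ containing constants with $L_s(Y)\subset Y$, $R_s(Y)\subset Y$ for all $s$ (as is $LUC(S)$), a left invariant mean on $Y$ is $\mu\in Y^*$ with $\|\mu\|=\mu(1)=1$ and $\mu(L_sf)=\mu(f)$ for all $s\in S$, $f\in Y$. Locally convex spaces are Hausdorff. A dynamical system $(S,K)$ consists of a semitopological semigroup $S$, a topological space $K$ and an action $\pi:S\times K\to K$, $(s,x)\mapsto sx$, with $s_1(s_2x)=(s_1s_2)x$, which is separately continuous (all maps $s\mapsto sx$ and all translations $x\mapsto sx$ are continuous). It is called continuous if $\pi$ is jointly continuous. $(S,(K,\mathrm{weak}))$ means that $K$ carries the weak topology. For $K$ in a locally convex space with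 topology determined by the family $Q$ of seminorms, the system is $Q$-nonexpansive if $p(sx-sy)\le p(x-y)$ for all $p\in Q$, $s\in S$, $x,y\in K$. A fixed point is $x\in K$ with $sx=x$ for all $s\in S$. *)

theory Defs
  imports "HOL-Analysis.Analysis"
begin

subsection \<open>Semitopological semigroups and left invariant means\<close>

class semitopological_semigroup = semigroup_mult + t2_space +
  assumes tendsto_left_mult: "((\<lambda>s. t * s) \<longlongrightarrow> t * a) (nhds a)"
    and tendsto_right_mult: "((\<lambda>s. s * t) \<longlongrightarrow> a * t) (nhds a)"

lemma continuous_left_mult: "continuous_on UNIV (\<lambda>s. t * s)"
  and continuous_right_mult: "continuous_on UNIV (\<lambda>s. s * t)"
  for t :: "'s::semitopological_semigroup"
  by (auto simp: continuous_on_def intro: tendsto_mono[OF _ tendsto_left_mult]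
      tendsto_mono[OF _ tendsto_right_mult] at_le simp: at_within_def)

definition left_translate :: "'s::semigroup_mult \<Rightarrow> ('s \<Rightarrow> complex) \<Rightarrow> ('s \<Rightarrow> complex)"
  where "left_translate s f = (\<lambda>t. f (s * t))"

lemma left_translate_bcontfun:
  fixes f :: "'s::semitopological_semigroup \<Rightarrow> complex"
  assumes "f \<in> bcontfun"
  shows "left_translate s f \<in> bcontfun"
proof -
  have "continuous_on UNIV f" "bounded (range f)"
    using assms by (auto simp: bcontfun_def)
  then have "continuous_on UNIV (\<lambda>t. f (s * t))" "bounded (range (\<lambda>t. f (s * t)))"
    using continuous_on_compose2[OF _ continuous_left_mult, of UNIV f s]
    by (auto intro: bounded_subset)
  then show ?thesis
    by (simp add: bcontfun_def left_translate_def)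
qed

(* Bcontfun only turns a bounded continuous function into an element of the normed space of
   bounded continuous functions, so that continuity below refers to the supremum norm; by
   left_translate_bcontfun it is never applied outside its domain here. *)
definition LUC :: "('s::semitopological_semigroup \<Rightarrow> complex) set"
  where "LUC = {f \<in> bcontfun. continuous_on UNIV (\<lambda>s. Bcontfun (left_translate s f))}"

lemma LUC_left_translate:
  assumes "f \<in> LUC"
  shows "left_translate a f \<in> LUC"
proof -
  have "continuous_on UNIV (\<lambda>s. Bcontfun (left_translate (a * s) f))"
    using assms continuous_on_compose2[OF _ continuous_left_mult, of UNIV _ a]
    by (auto simp: LUC_def)
  moreover have "left_translate (a * s) f = left_translate s (left_translate a f)" for s
    by (simp add: left_translate_def mult.assoc)
  ultimately show ?thesis
    using assms by (simp add: LUC_def left_translate_bcontfun)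
qed

definition sup_norm :: "('s \<Rightarrow> complex) \<Rightarrow> real"
  where "sup_norm f = (SUP t. cmod (f t))"

(* Functionals on a subspace Y of the bounded functions are represented by functions on all of
   's => complex, of which only the values on Y matter. *)
definition in_dual :: "('s \<Rightarrow> complex) set \<Rightarrow> (('s \<Rightarrow> complex) \<Rightarrow> complex) \<Rightarrow> bool"
  where "in_dual Y \<mu> \<longleftrightarrow>
    (\<forall>f\<in>Y. \<forall>g\<in>Y. \<mu> (\<lambda>t. f t + g t) = \<mu> f + \<mu> g) \<and>
    (\<forall>c. \<forall>f\<in>Y. \<mu> (\<lambda>t. c * f t) = c * \<mu> f) \<and>
    (\<exists>B. \<forall>f\<in>Y. cmod (\<mu> f) \<le> B * sup_norm f)"

definition dual_norm :: "('s \<Rightarrow> complex) set \<Rightarrow> (('s \<Rightarrow> complex) \<Rightarrow> complex) \<Rightarrow> real"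
  where "dual_norm Y \<mu> = (SUP f\<in>{f \<in> Y. sup_norm f \<le> 1}. cmod (\<mu> f))"

definition left_invariant_mean ::
    "('s::semigroup_mult \<Rightarrow> complex) set \<Rightarrow> (('s \<Rightarrow> complex) \<Rightarrow> complex) \<Rightarrow> bool"
  where "left_invariant_mean Y \<mu> \<longleftrightarrow>
    in_dual Y \<mu> \<and> dual_norm Y \<mu> = 1 \<and> \<mu> (\<lambda>_. 1) = 1 \<and>
    (\<forall>s. \<forall>f\<in>Y. \<mu> (left_translate s f) = \<mu> f)"


subsection \<open>Locally convex spaces\<close>

definition seminorm :: "('x::real_vector \<Rightarrow> real) \<Rightarrow> bool"
  where "seminorm p \<longleftrightarrow>
    (\<forall>x y. p (x + y) \<le> p x + p y) \<and> (\<forall>c x. p (c *\<^sub>R x) = \<bar>c\<bar> * p x)"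

(* The type carries the topology of the space and t2_space makes it Hausdorff; being generated by
   seminorms makes it a locally convex vector topology. A complex locally convex space is covered
   by its underlying real one: its seminorms, convex sets and weak topology are the same or are
   instances of the real notions. *)
definition topology_determined_by ::
    "('x::{real_vector, t2_space} \<Rightarrow> real) set \<Rightarrow> bool"
  where "topology_determined_by Q \<longleftrightarrow>
    (\<forall>p\<in>Q. seminorm p \<and> continuous_on UNIV p) \<and>
    (\<forall>U. open U \<longleftrightarrow>
      (\<forall>x\<in>U. \<exists>F e. finite F \<and> F \<subseteq> Q \<and> e > 0 \<and> {y. \<forall>p\<in>F. p (y - x) < e} \<subseteq> U))"

definition weak_topology :: "'x::{real_vector, t2_space} topology"
  where "weak_topology = topology_generated_by
    {f -` U | (f :: 'x \<Rightarrow> real) U. linear f \<and> continuous_on UNIV f \<and> open U}"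

lemma topspace_weak_topology [simp]:
  "topspace (weak_topology :: 'x::{real_vector, t2_space} topology) = UNIV"
proof -
  have "linear (\<lambda>_::'x. 0::real)" "continuous_on UNIV (\<lambda>_::'x. 0::real)"
    by (simp_all add: linear_iff)
  then have "(\<lambda>_::'x. 0::real) -` UNIV \<in>
      {f -` U | (f :: 'x \<Rightarrow> real) U. linear f \<and> continuous_on UNIV f \<and> open U}"
    by blast
  then show ?thesis
    unfolding weak_topology_def topology_generated_by_topspace by auto
qed


subsection \<open>Dynamical systems\<close>

definition dynamical_system ::
    "'x topology \<Rightarrow> ('s::semitopological_semigroup \<Rightarrow> 'x \<Rightarrow> 'x) \<Rightarrow> bool"
  where "dynamical_system T act \<longleftrightarrow>
    (\<forall>s. \<forall>x\<in>topspace T. act s x \<in> topspace T) \<and>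
    (\<forall>s1 s2. \<forall>x\<in>topspace T. act s1 (act s2 x) = act (s1 * s2) x) \<and>
    (\<forall>x\<in>topspace T. continuous_map euclidean T (\<lambda>s. act s x)) \<and>
    (\<forall>s. continuous_map T T (act s))"

definition continuous_dynamical_system ::
    "'x topology \<Rightarrow> ('s::semitopological_semigroup \<Rightarrow> 'x \<Rightarrow> 'x) \<Rightarrow> bool"
  where "continuous_dynamical_system T act \<longleftrightarrow>
    dynamical_system T act \<and>
    continuous_map (prod_topology euclidean T) T (\<lambda>(s, x). act s x)"

definition nonexpansive_on ::
    "('x::real_vector \<Rightarrow> real) set \<Rightarrow> 'x set \<Rightarrow> ('s \<Rightarrow> 'x \<Rightarrow> 'x) \<Rightarrow> bool"
  where "nonexpansive_on Q K act \<longleftrightarrow>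
    (\<forall>p\<in>Q. \<forall>s. \<forall>x\<in>K. \<forall>y\<in>K. p (act s x - act s y) \<le> p (x - y))"

end

theory Submission
  imports Defs
begin

text \<open>
  By Zorn's lemma take a minimal nonempty closed convex invariant set \<open>K\<^sub>0\<close> in \<open>K\<close> and a minimal
  nonempty closed invariant set \<open>F\<close> in \<open>K\<^sub>0\<close>. Joint continuity makes \<open>s \<mapsto> f (s x)\<close> an element of
  \<open>LUC(S)\<close> for every \<open>x \<in> F\<close> and every weakly continuous \<open>f\<close> on \<open>F\<close>, so the left invariant mean
  induces an invariant mean on \<open>C(F)\<close>; by minimality it is strictly positive on nonzero nonnegative
  functions, which forces \<open>s F = F\<close> for all \<open>s\<close>.

  Let \<open>p \<in> Q\<close>. The weakly compact set \<open>F\<close> has nonempty relatively weakly open subsets \<open>W\<close> of arbitrarily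
  small \<open>p\<close>-diameter. As \<open>p\<close> is not increased by the action, every small \<open>p\<close>-ball around a point of the
  orbit of a point \<open>u \<in> W\<close> has at least the mass of \<open>W\<close>. Hence only finitely many such balls are
  disjoint, and \<open>F\<close> has finite \<open>p\<close>-nets. If the \<open>p\<close>-diameter \<open>d\<close> of \<open>F\<close> were positive, the average \<open>y\<close> of
  a \<open>d / 2\<close>-net would satisfy \<open>p (y - x) \<le> r < d\<close> for all \<open>x \<in> F\<close>; the points of \<open>K\<^sub>0\<close> with this
  property form a closed convex set, invariant because \<open>s F = F\<close>, so it is \<open>K\<^sub>0\<close> and contains \<open>F\<close>,
  a contradiction. Therefore \<open>F\<close> is a single point.
\<close>

section \<open>The Hahn-Banach theorem for seminorms\<close>

definition sublinear :: "('x::real_vector \<Rightarrow> real) \<Rightarrow> bool"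
  where "sublinear g \<longleftrightarrow>
    (\<forall>x y. g (x + y) \<le> g x + g y) \<and> (\<forall>c x. c \<ge> 0 \<longrightarrow> g (c *\<^sub>R x) = c * g x)"

lemma sublinear_add: "sublinear g \<Longrightarrow> g (x + y) \<le> g x + g y"
  and sublinear_scaleR: "sublinear g \<Longrightarrow> c \<ge> 0 \<Longrightarrow> g (c *\<^sub>R x) = c * g x"
  by (auto simp: sublinear_def)

lemma sublinear_zero: "sublinear g \<Longrightarrow> g 0 = 0"
  using sublinear_scaleR[of g 0 0] by simp

lemma sublinear_minus: "sublinear g \<Longrightarrow> - g (- x) \<le> g x"
  using sublinear_add[of g x "- x"] sublinear_zero[of g] by simp

text \<open>The witness is the infimum of \<open>g (x + t *\<^sub>R y) - t * g y\<close> over t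
  \<ge> 0, which is bounded below by \<open>- g (- x)\<close>. Taking \<open>t = 0\<close> gives
  \<open>h \<le> g\<close>, and \<open>t = 1\<close> gives the bound at \<open>- y\<close>.\<close>

lemma sublinear_tilt:
  assumes "sublinear g"
  obtains h where "sublinear h" "h \<le> g" "h (- y) \<le> - g y"
proof -
  define h where "h x = (INF t\<in>{0..}. g (x + t *\<^sub>R y) - t * g y)" for x
  have bound: "- g (- x) \<le> g (x + t *\<^sub>R y) - t * g y" if "t \<ge> 0" for x t
    using sublinear_add[OF assms, of "- x" "x + t *\<^sub>R y"] sublinear_scaleR[OF assms that, of y] by simp
  have bdd: "bdd_below ((\<lambda>t. g (x + t *\<^sub>R y) - t * g y) ` {0..})" for x
    by (rule bdd_belowI[of _ "- g (- x)"]) (use bound in auto)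
  have le: "h x \<le> g (x + t *\<^sub>R y) - t * g y" if "t \<ge> 0" for x t
    unfolding h_def using that by (intro cINF_lower bdd) auto
  have ge: "b \<le> h x" if "\<And>t. t \<ge> 0 \<Longrightarrow> b \<le> g (x + t *\<^sub>R y) - t * g y" for b x
    unfolding h_def using that by (intro cINF_greatest) auto
  have add: "h (x + z) \<le> h x + h z" for x z
  proof -
    \<comment> \<open>The parameters \<open>t\<close> for \<open>x\<close> and \<open>u\<close> for
      \<open>z\<close> combine to \<open>t + u\<close> for \<open>x + z\<close>; the two infima are
      then taken one after the other.\<close>
    have 1: "h (x + z) - (g (z + u *\<^sub>R y) - u * g y) \<le> g (x + t *\<^sub>R y) - t * g y"
      if "t \<ge> 0" "u \<ge> 0" for t u
      using le[of "t + u" "x + z"] sublinear_add[OF assms, of "x + t *\<^sub>R y" "z + u *\<^sub>R y"] that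
      by (simp add: algebra_simps)
    have "h (x + z) - h x \<le> g (z + u *\<^sub>R y) - u * g y" if "u \<ge> 0" for u
      using ge[OF 1[OF _ that]] by simp
    from ge[OF this] show ?thesis by simp
  qed
  have scale_le: "h (c *\<^sub>R x) \<le> c * h x" if "c > 0" for c x
  proof -
    have "h (c *\<^sub>R x) / c \<le> g (x + t *\<^sub>R y) - t * g y" if "t \<ge> 0" for t
      using le[of "c * t" "c *\<^sub>R x"] sublinear_scaleR[OF assms, of c "x + t *\<^sub>R y"] that \<open>c > 0\<close>
      by (simp add: field_simps)
    from ge[OF this] show ?thesis using \<open>c > 0\<close> by (simp add: field_simps)
  qed
  have scale: "h (c *\<^sub>R x) = c * h x" if "c \<ge> 0" for c x
  proof (cases "c = 0")
    case True
    have "h 0 \<le> 0" using le[of 0 0] sublinear_zero[OF assms] by simp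
    moreover have "0 \<le> h 0"
      using ge[of 0 0] bound[of _ 0] sublinear_zero[OF assms] by simp
    ultimately show ?thesis using True by simp
  next
    case False
    then have "c > 0" using that by simp
    moreover have "h x \<le> inverse c * h (c *\<^sub>R x)"
      using scale_le[of "inverse c" "c *\<^sub>R x"] \<open>c > 0\<close> by simp
    ultimately show ?thesis using scale_le[of c x] by (simp add: field_simps)
  qed
  show thesis
  proof
    show "sublinear h" using add scale by (simp add: sublinear_def)
    show "h \<le> g" using le[of 0] by (simp add: le_fun_def)
    show "h (- y) \<le> - g y" using le[of 1 "- y"] sublinear_zero[OF assms] by simp
  qed
qed

text \<open>A minimal sublinear functional is linear, since \<open>sublinear_tilt\<close> cannot decrease it.\<close>

lemma sublinear_dominates_linear:
  assumes "sublinear g"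
  obtains f where "linear f" "f \<le> g"
proof -
  define A where "A = {h. sublinear h \<and> h \<le> g}"
  let ?P = "\<lambda>f h :: 'a \<Rightarrow> real. h \<le> f"
  have po: "partial_order_on A (relation_of ?P A)"
    by (rule partial_order_on_relation_ofI) auto
  have "\<exists>u\<in>A. \<forall>a\<in>C. u \<le> a" if "C \<in> Chains (relation_of ?P A)" for C
  proof (cases "C = {}")
    case True
    then show ?thesis using assms by (auto simp: A_def)
  next
    case False
    have CA: "C \<subseteq> A" and tot: "\<And>a b. a \<in> C \<Longrightarrow> b \<in> C \<Longrightarrow> a \<le> b \<or> b \<le> a"
      using that by (auto simp: Chains_def relation_of_def)
    \<comment> \<open>The pointwise infimum is the lower bound of the chain; it is finite because
      all members lie below \<open>g\<close>, which bounds them from below by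
      \<open>- g (- x)\<close>.\<close>
    define u where "u x = (INF h\<in>C. h x)" for x
    have lower: "- g (- x) \<le> h x" if "h \<in> C" for h x
    proof -
      have "sublinear h" "h (- x) \<le> g (- x)" using CA that by (auto simp: A_def le_fun_def)
      then show ?thesis using sublinear_minus[of h x] by simp
    qed
    have bdd: "bdd_below ((\<lambda>h. h x) ` C)" for x
      by (rule bdd_belowI[of _ "- g (- x)"]) (use lower in auto)
    have le: "u x \<le> h x" if "h \<in> C" for h x
      unfolding u_def using that by (intro cINF_lower bdd)
    have ge: "b \<le> u x" if "\<And>h. h \<in> C \<Longrightarrow> b \<le> h x" for b x
      unfolding u_def using that False by (intro cINF_greatest) auto
    have add: "u (x + y) \<le> u x + u y" for x y
    proof -
      have "u (x + y) - k y \<le> h x" if "h \<in> C" "k \<in> C" for h k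
      proof -
        \<comment> \<open>The smaller of \<open>h\<close> and \<open>k\<close> serves both
          arguments, so subadditivity of a single member applies.\<close>
        obtain l where "l \<in> C" "l \<le> h" "l \<le> k"
          using tot[of h k] \<open>h \<in> C\<close> \<open>k \<in> C\<close> by blast
        then have "u (x + y) \<le> l x + l y"
          using le[of l "x + y"] sublinear_add[of l x y] CA by (force simp: A_def)
        moreover have "l x \<le> h x" "l y \<le> k y"
          using \<open>l \<le> h\<close> \<open>l \<le> k\<close> by (auto simp: le_fun_def)
        ultimately show ?thesis by simp
      qed
      then have "u (x + y) - u x \<le> k y" if "k \<in> C" for k
        using ge[of "u (x + y) - k y" x] that by force
      then show ?thesis using ge[of "u (x + y) - u x" y] by simp
    qed
    have hom: "h (c *\<^sub>R x) = c * h x" if "h \<in> C" "c \<ge> 0" for h c x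
      using CA that by (auto simp: A_def sublinear_scaleR)
    have scale: "u (c *\<^sub>R x) = c * u x" if "c \<ge> 0" for c x
    proof (cases "c = 0")
      case True
      obtain h where "h \<in> C" using \<open>C \<noteq> {}\<close> by blast
      have "u 0 \<le> 0" using le[OF \<open>h \<in> C\<close>, of 0] hom[OF \<open>h \<in> C\<close>, of 0 0] by simp
      moreover have "h 0 = 0" if "h \<in> C" for h using hom[OF that, of 0 0] by simp
      then have "0 \<le> u 0" by (intro ge) (metis order_refl)
      ultimately show ?thesis using True by simp
    next
      case False
      then have c: "c > 0" using that by simp
      have "u (c *\<^sub>R x) / c \<le> u x"
        using le hom c by (intro ge) (force simp: field_simps)
      moreover have "c * u x \<le> u (c *\<^sub>R x)"
        using le hom c by (intro ge) (force simp: field_simps)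
      ultimately show ?thesis using c by (simp add: field_simps)
    qed
    have "u \<le> g"
    proof -
      obtain h where "h \<in> C" using False by blast
      then have "u \<le> h" "h \<le> g" using le CA by (auto simp: le_fun_def A_def)
      then show ?thesis by simp
    qed
    then have "u \<in> A" using add scale by (simp add: A_def sublinear_def)
    then show ?thesis using le by (auto simp: le_fun_def)
  qed
  from predicate_Zorn[OF po this]
  obtain f where f: "f \<in> A" and min: "\<And>h. h \<in> A \<Longrightarrow> h \<le> f \<Longrightarrow> h = f" by blast
  have sub: "sublinear f" using f by (simp add: A_def)
  have neg: "f (- y) = - f y" for y
  proof -
    obtain h where h: "sublinear h" "h \<le> f" "h (- y) \<le> - f y"
      using sublinear_tilt[OF sub] by blast
    then have "h = f" using f by (intro min) (auto simp: A_def)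
    then show ?thesis using h sublinear_minus[OF sub, of "y"] by simp
  qed
  have add: "f (x + y) = f x + f y" for x y
    using sublinear_add[OF sub, of x y] sublinear_add[OF sub, of "- x" "- y"] neg[of x] neg[of y]
      neg[of "x + y"] by simp
  have "f (c *\<^sub>R x) = c * f x" for c x
  proof (cases "c \<ge> 0")
    case False
    then have "f (- (c *\<^sub>R x)) = - c * f x"
      using sublinear_scaleR[OF sub, of "- c" x] by simp
    then show ?thesis using neg[of "c *\<^sub>R x"] by simp
  qed (simp add: sublinear_scaleR[OF sub])
  then have "linear f" using add by (simp add: linear_iff)
  moreover have "f \<le> g" using f by (simp add: A_def)
  ultimately show thesis by (rule that)
qed

section \<open>Seminorms and norming functionals\<close>

lemma seminorm_add: "seminorm p \<Longrightarrow> p (x + y) \<le> p x + p y"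
  and seminorm_scaleR: "seminorm p \<Longrightarrow> p (c *\<^sub>R x) = \<bar>c\<bar> * p x"
  by (auto simp: seminorm_def)

lemma seminorm_zero: "seminorm p \<Longrightarrow> p 0 = 0"
  using seminorm_scaleR[of p 0 0] by simp

lemma seminorm_minus: "seminorm p \<Longrightarrow> p (- x) = p x"
  using seminorm_scaleR[of p "- 1" x] by simp

lemma seminorm_commute: "seminorm p \<Longrightarrow> p (x - y) = p (y - x)"
  using seminorm_minus[of p "x - y"] by simp

lemma seminorm_triangle: "seminorm p \<Longrightarrow> p (x - z) \<le> p (x - y) + p (y - z)"
  using seminorm_add[of p "x - y" "y - z"] by simp

lemma seminorm_nonneg: "seminorm p \<Longrightarrow> 0 \<le> p x"
  using seminorm_add[of p x "- x"] seminorm_zero[of p] seminorm_minus[of p x] by simp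

text \<open>The tilt of \<open>p\<close> at \<open>z\<close> satisfies
  \<open>h (- z) \<le> - p z\<close>, which forces every linear \<open>f \<le> h\<close> to have
  \<open>f z \<ge> p z\<close>.\<close>

lemma Hahn_Banach_seminorm:
  assumes "seminorm p"
  obtains f where "linear f" "\<And>x. f x \<le> p x" "f z = p z"
proof -
  have "sublinear p" using assms by (auto simp: seminorm_def sublinear_def)
  from sublinear_tilt[OF this, of z]
  obtain h where h: "sublinear h" "h \<le> p" "h (- z) \<le> - p z" by blast
  obtain f where f: "linear f" "f \<le> h" using sublinear_dominates_linear[OF h(1)] .
  have le: "f x \<le> p x" for x using f(2) h(2) by (meson le_funD order_trans)
  moreover have "f z = p z"
  proof -
    have "- f z \<le> - p z"
      using le_funD[OF f(2), of "- z"] h(3) linear_neg[OF f(1), of z] by simp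
    then show ?thesis using le[of z] by simp
  qed
  ultimately show thesis using that f(1) by blast
qed

section \<open>The weak topology\<close>

lemma continuous_map_weak:
  assumes "linear f" "continuous_on UNIV f"
  shows "continuous_map weak_topology euclideanreal f"
proof -
  have "openin weak_topology (f -` U)" if "open U" for U
    unfolding weak_topology_def by (rule topology_generated_by_Basis) (use assms that in blast)
  then show ?thesis by (simp add: continuous_map vimage_def)
qed

lemma linear_dominated_continuous:
  assumes Q: "topology_determined_by Q" "p \<in> Q" and f: "linear f" "\<And>x. f x \<le> p x"
  shows "continuous_on UNIV f"
proof -
  have p: "seminorm p" using Q by (auto simp: topology_determined_by_def)
  have abs: "\<bar>f y - f x\<bar> \<le> p (y - x)" for x y
    using f(2)[of "y - x"] f(2)[of "x - y"] seminorm_commute[OF p, of x y]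
    by (simp add: linear_diff[OF f(1)])
  have "\<exists>F e. finite F \<and> F \<subseteq> Q \<and> e > 0 \<and> {y. \<forall>p\<in>F. p (y - x) < e} \<subseteq> f -` B"
    if B: "open B" and "x \<in> f -` B" for B x
  proof -
    have "f x \<in> B" using that by simp
    then obtain e where e: "e > 0" "ball (f x) e \<subseteq> B" using openE[OF B] by blast
    have "{y. \<forall>p\<in>{p}. p (y - x) < e} \<subseteq> f -` B"
    proof clarsimp
      fix y assume "p (y - x) < e"
      then have "f y \<in> ball (f x) e" using abs[of y x] by (simp add: dist_real_def)
      then show "f y \<in> B" using e by blast
    qed
    then show ?thesis using e Q(2) by (intro exI[of _ "{p}"] exI[of _ e]) auto
  qed
  then have "open (f -` B)" if "open B" for B
    using Q that by (simp add: topology_determined_by_def)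
  then show ?thesis by (simp add: continuous_on_open_vimage)
qed

lemma exists_norming_functional:
  assumes "topology_determined_by Q" "p \<in> Q"
  obtains f where "linear f" "\<And>x. f x \<le> p x" "f z = p z"
    "continuous_map weak_topology euclideanreal f"
proof -
  have p: "seminorm p" using assms by (auto simp: topology_determined_by_def)
  obtain f where "linear f" "\<And>x. f x \<le> p x" "f z = p z"
    using Hahn_Banach_seminorm[OF p, of z] by blast
  then show thesis
    using that linear_dominated_continuous[OF assms] continuous_map_weak by blast
qed

text \<open>Weak lower semicontinuity of \<open>p\<close>: a functional norming \<open>x - y\<close>
  exceeds \<open>r + f y\<close> on a weak neighbourhood of \<open>x\<close>, and for
  \<open>v\<close> there p (v - y) \<ge> f v - f y > r.\<close>

lemma openin_weak_seminorm_gt: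
  assumes "topology_determined_by Q" "p \<in> Q"
  shows "openin weak_topology {x. r < p (x - y)}"
proof (subst openin_subopen, clarify)
  fix x assume x: "r < p (x - y)"
  obtain f where f: "linear f" "\<And>x. f x \<le> p x" "f (x - y) = p (x - y)"
    "continuous_map weak_topology euclideanreal f"
    using exists_norming_functional[OF assms, of "x - y"] by blast
  let ?U = "{v \<in> topspace weak_topology. f v \<in> {r + f y<..}}"
  have "openin weak_topology ?U"
    by (rule openin_continuous_map_preimage[OF f(4)]) simp
  moreover have "x \<in> ?U" using f x by (simp add: linear_diff)
  moreover have "?U \<subseteq> {x. r < p (x - y)}"
  proof clarsimp
    fix v assume "r + f y < f v"
    then show "r < p (v - y)" using f(2)[of "v - y"] by (simp add: linear_diff[OF f(1)])
  qed
  ultimately show "\<exists>T. openin weak_topology T \<and> x \<in> T \<and> T \<subseteq> {x. r < p (x - y)}" by blast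
qed

lemma closedin_weak_seminorm_le:
  assumes "topology_determined_by Q" "p \<in> Q"
  shows "closedin weak_topology {x. p (x - y) \<le> r}"
proof -
  have "topspace weak_topology - {x. p (x - y) \<le> r} = {x. r < p (x - y)}" by auto
  then show ?thesis using openin_weak_seminorm_gt[OF assms] by (simp add: closedin_def)
qed

lemma seminorms_separate_points:
  fixes x y :: "'x::{real_vector, t2_space}"
  assumes "topology_determined_by Q" "\<And>p. p \<in> Q \<Longrightarrow> p (x - y) = 0"
  shows "x = y"
proof (rule ccontr)
  assume "x \<noteq> y"
  then obtain U where U: "open U" "y \<in> U" "x \<notin> U" by (metis hausdorff disjoint_iff)
  have "\<forall>v\<in>U. \<exists>F e. finite F \<and> F \<subseteq> Q \<and> e > 0 \<and> {w. \<forall>p\<in>F. p (w - v) < e} \<subseteq> U"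
    using assms(1) U(1) by (simp add: topology_determined_by_def)
  then obtain F e where F: "F \<subseteq> Q" "e > 0" "{v. \<forall>p\<in>F. p (v - y) < e} \<subseteq> U"
    using U(2) by blast
  have "p (x - y) < e" if "p \<in> F" for p
    using assms(2)[of p] F that by auto
  then have "x \<in> U" using F(3) by blast
  then show False using U by blast
qed

lemma Hausdorff_weak_topology:
  fixes Q :: "('x::{real_vector, t2_space} \<Rightarrow> real) set"
  assumes Q: "topology_determined_by Q"
  shows "Hausdorff_space (weak_topology :: 'x topology)"
  unfolding Hausdorff_space_def
proof clarify
  fix x y :: 'x assume "x \<noteq> y"
  then obtain p where p: "p \<in> Q" "p (x - y) \<noteq> 0" using seminorms_separate_points[OF Q] by blast
  obtain f where f: "linear f" "\<And>x. f x \<le> p x" "f (x - y) = p (x - y)"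
    "continuous_map weak_topology euclideanreal f"
    using exists_norming_functional[OF Q p(1), of "x - y"] by blast
  then have "f x \<noteq> f y" using p by (simp add: linear_diff)
  then obtain A B where AB: "open A" "open B" "f x \<in> A" "f y \<in> B" "A \<inter> B = {}"
    by (metis hausdorff)
  have "openin weak_topology {v \<in> topspace weak_topology. f v \<in> A}"
    "openin weak_topology {v \<in> topspace weak_topology. f v \<in> B}"
    using AB openin_continuous_map_preimage[OF f(4), of A] openin_continuous_map_preimage[OF f(4), of B]
    by auto
  then show "\<exists>U V. openin weak_topology U \<and> openin weak_topology V \<and> x \<in> U \<and> y \<in> V \<and> disjnt U V"
    using AB
    by (intro exI[of _ "{v \<in> topspace weak_topology. f v \<in> A}"]
        exI[of _ "{v \<in> topspace weak_topology. f v \<in> B}"]) (auto simp: disjnt_def)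
qed


section \<open>Weakly compact sets are fragmented by continuous seminorms\<close>

text \<open>The \<open>p\<close>-distance \<open>q\<close> to \<open>span A\<close> is a seminorm
  below \<open>p\<close> that vanishes on \<open>span A\<close>. A functional dominated by
  \<open>q\<close> with \<open>f z = q z\<close> is weakly continuous and kills \<open>A\<close>, so
  the hypothesis makes the distance of \<open>z\<close> zero.\<close>

lemma weakly_dense_span_dense:
  assumes Q: "topology_determined_by Q" "p \<in> Q"
    and z: "\<And>f. linear f \<Longrightarrow> continuous_map weak_topology euclideanreal f \<Longrightarrow>
      (\<And>a. a \<in> A \<Longrightarrow> f a = (0::real)) \<Longrightarrow> f z = 0"
    and e: "e > 0"
  shows "\<exists>v\<in>span A. p (z - v) < e"
proof (rule ccontr)
  assume "\<not> ?thesis"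
  then have far: "e \<le> p (z - v)" if "v \<in> span A" for v using that by force
  have p: "seminorm p" using Q by (auto simp: topology_determined_by_def)
  define q where "q y = (INF v\<in>span A. p (y - v))" for y
  have le: "q y \<le> p (y - v)" if "v \<in> span A" for y v
    unfolding q_def using that seminorm_nonneg[OF p]
    by (intro cINF_lower bdd_belowI[of _ 0]) auto
  have ge: "b \<le> q y" if "\<And>v. v \<in> span A \<Longrightarrow> b \<le> p (y - v)" for b y
    unfolding q_def using that span_zero by (intro cINF_greatest) auto
  have zero: "q v = 0" if "v \<in> span A" for v
    using le[OF that, of v] ge[of 0 v] seminorm_nonneg[OF p] seminorm_zero[OF p] by force
  have add: "q (x + y) \<le> q x + q y" for x y
  proof -
    have "q (x + y) - p (y - w) \<le> p (x - v)" if "v \<in> span A" "w \<in> span A" for v w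
      using le[OF span_add[OF that], of "x + y"] seminorm_add[OF p, of "x - v" "y - w"]
      by (simp add: algebra_simps)
    then have "q (x + y) - q x \<le> p (y - w)" if "w \<in> span A" for w
      using ge[of "q (x + y) - p (y - w)" x] that by force
    then show ?thesis using ge[of "q (x + y) - q x" y] by simp
  qed
  have scale_le: "q (c *\<^sub>R x) \<le> \<bar>c\<bar> * q x" if "c \<noteq> 0" for c x
  proof -
    have "q (c *\<^sub>R x) / \<bar>c\<bar> \<le> p (x - v)" if "v \<in> span A" for v
      using le[OF span_scale[OF that, of c], of "c *\<^sub>R x"] \<open>c \<noteq> 0\<close> seminorm_scaleR[OF p, of c "x - v"]
      by (simp add: field_simps)
    from ge[OF this] show ?thesis using \<open>c \<noteq> 0\<close> by (simp add: field_simps)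
  qed
  have scale: "q (c *\<^sub>R x) = \<bar>c\<bar> * q x" for c x
  proof (cases "c = 0")
    case True
    then show ?thesis using zero[OF span_zero] by simp
  next
    case False
    have "q x \<le> \<bar>inverse c\<bar> * q (c *\<^sub>R x)"
      using scale_le[of "inverse c" "c *\<^sub>R x"] False by simp
    then show ?thesis using scale_le[OF False, of x] False by (simp add: field_simps)
  qed
  have "seminorm q" using add scale by (simp add: seminorm_def)
  then obtain f where f: "linear f" "\<And>x. f x \<le> q x" "f z = q z"
    using Hahn_Banach_seminorm[of q z] by blast
  have "f x \<le> p x" for x using f(2)[of x] le[OF span_zero, of x] by simp
  then have "continuous_map weak_topology euclideanreal f"
    by (intro continuous_map_weak linear_dominated_continuous[OF Q] f(1))
  moreover have "f a = 0" if "a \<in> A" for a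
    using f(2)[of a] f(2)[of "- a"] zero[OF span_base[OF that]]
      zero[OF span_neg[OF span_base[OF that]]] linear_neg[OF f(1), of a] by simp
  ultimately have "q z = 0" using z[OF f(1)] f(3) by simp
  moreover have "e \<le> q z" using far by (rule ge)
  ultimately show False using e by simp
qed

text \<open>Coding the approximants by lists of rational-index pairs makes them a countable family
  when the index type is countable. Each induction step spends half of the error on the new
  coefficient.\<close>

lemma span_rational_approximation:
  fixes x :: "'i \<Rightarrow> 'x::real_vector"
  assumes p: "seminorm p" and v: "v \<in> span (range x)" and e: "e > 0"
  shows "\<exists>l :: (rat \<times> 'i) list. p (v - (\<Sum>(r, i)\<leftarrow>l. real_of_rat r *\<^sub>R x i)) < e"
  using v e
proof (induction arbitrary: e rule: span_induct_alt)
  case base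
  then show ?case using seminorm_zero[OF p] by (intro exI[of _ "[]"]) simp
next
  case (step c a y)
  from step.hyps obtain i where i: "a = x i" by blast
  from step.IH[of "e / 2"] step.prems obtain l :: "(rat \<times> 'i) list"
    where l: "p (y - (\<Sum>(r, i)\<leftarrow>l. real_of_rat r *\<^sub>R x i)) < e / 2" by auto
  \<comment> \<open>The summand 1 covers the case \<open>p a = 0\<close>; since p a / (p a + 1)
    \<le> 1, the error of the new term is at most \<open>e / 2\<close>.\<close>
  have "e / 2 / (p a + 1) > 0" using step.prems seminorm_nonneg[OF p, of a] by simp
  then obtain r where r: "c < real_of_rat r" "real_of_rat r < c + e / 2 / (p a + 1)"
    using of_rat_dense[of c "c + e / 2 / (p a + 1)"] by auto
  have "\<bar>c - real_of_rat r\<bar> * p a \<le> e / 2 / (p a + 1) * p a"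
    using r seminorm_nonneg[OF p, of a] by (intro mult_right_mono) auto
  also have "\<dots> \<le> e / 2"
    using step.prems seminorm_nonneg[OF p, of a] by (simp add: field_simps)
  finally have "p ((c - real_of_rat r) *\<^sub>R a) \<le> e / 2" by (simp add: seminorm_scaleR[OF p])
  then have "p (c *\<^sub>R a + y - (\<Sum>(r, i)\<leftarrow>(r, i) # l. real_of_rat r *\<^sub>R x i)) < e"
    using l i seminorm_add[OF p, of "(c - real_of_rat r) *\<^sub>R a" "y - (\<Sum>(r, i)\<leftarrow>l. real_of_rat r *\<^sub>R x i)"]
    by (simp add: algebra_simps)
  then show ?case by blast
qed

text \<open>
  Otherwise a binary tree of relatively weakly open sets, each pair of siblings separated by a gap
  \<open>e\<close> of a functional dominated by \<open>p\<close>, has uncountably many branches whose cluster points are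
  \<open>e\<close>-separated for \<open>p\<close>. But these lie in the closed span of one countable set, which is
  \<open>p\<close>-separable.
\<close>

lemma weakly_compact_fragmented:
  fixes Q :: "('x::{real_vector, t2_space} \<Rightarrow> real) set"
  assumes Q: "topology_determined_by Q" "p \<in> Q"
    and F: "compactin weak_topology F" "F \<noteq> {}" and e: "e > 0"
  shows "\<exists>W. openin weak_topology W \<and> W \<inter> F \<noteq> {} \<and> (\<forall>x\<in>W \<inter> F. \<forall>y\<in>W \<inter> F. p (x - y) \<le> e)"
proof (rule ccontr)
  assume contra: "\<not> ?thesis"
  let ?w = "weak_topology :: 'x topology"
  have p: "seminorm p" using Q by (auto simp: topology_determined_by_def)
  define good where "good V \<longleftrightarrow> openin ?w V \<and> V \<inter> F \<noteq> {}" for V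
  define splits where "splits V f a V0 V1 \<longleftrightarrow> linear f \<and> (\<forall>x. f x \<le> p x) \<and>
      continuous_map ?w euclideanreal f \<and> good V0 \<and> good V1 \<and> V0 \<subseteq> V \<and> V1 \<subseteq> V \<and>
      (\<forall>x\<in>V0. a + e \<le> f x) \<and> (\<forall>x\<in>V1. f x \<le> a)" for V f a V0 V1
  have "\<exists>f a V0 V1. splits V f a V0 V1" if V: "good V" for V
  proof -
    obtain x y where xy: "x \<in> V \<inter> F" "y \<in> V \<inter> F" "e < p (x - y)"
      using contra V unfolding good_def by (meson not_le_imp_less)
    obtain f where f: "linear f" "\<And>x. f x \<le> p x" "f (x - y) = p (x - y)"
      "continuous_map ?w euclideanreal f"
      using exists_norming_functional[OF Q, of "x - y"] by blast
    have "f y < f x - e" using xy f by (simp add: linear_diff)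
    \<comment> \<open>The strict room around \<open>a\<close> lets strict inequalities cut out open
      sets that still contain \<open>x\<close> and \<open>y\<close>; \<open>splits\<close> keeps the
      non-strict ones, which pass to cluster points.\<close>
    then obtain a where a: "f y < a" "a < f x - e" using dense by blast
    define V0 where "V0 = V \<inter> {v \<in> topspace ?w. f v \<in> {a + e<..}}"
    define V1 where "V1 = V \<inter> {v \<in> topspace ?w. f v \<in> {..<a}}"
    have "openin ?w V0" "openin ?w V1"
      unfolding V0_def V1_def using V
      by (auto simp: good_def simp del: topspace_weak_topology mem_Collect_eq greaterThan_iff lessThan_iff
          intro!: openin_Int openin_continuous_map_preimage[OF f(4)])
    moreover have "x \<in> V0 \<inter> F" "y \<in> V1 \<inter> F" using xy a by (auto simp: V0_def V1_def)
    ultimately have "good V0" "good V1" by (auto simp: good_def)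
    then have "splits V f a V0 V1"
      using f(1,2,4) by (auto simp: splits_def V0_def V1_def)
    then show ?thesis by blast
  qed
  then obtain f a c0 c1 where split: "\<And>V. good V \<Longrightarrow> splits V (f V) (a V) (c0 V) (c1 V)"
    by metis
  \<comment> \<open>A node is the list of choices leading to it, the last one at the head.\<close>
  define V where "V l = foldr (\<lambda>b W. if b then c0 W else c1 W) l UNIV" for l
  have good: "good (V l)" for l
  proof (induction l)
    case Nil
    have "openin ?w UNIV" using openin_topspace[of ?w] by simp
    then show ?case using F by (simp add: V_def good_def)
  next
    case (Cons b l)
    then show ?case using split[of "V l"] by (simp add: V_def splits_def)
  qed
  have "\<forall>l. \<exists>x. x \<in> V l \<inter> F" using good by (auto simp: good_def)
  then obtain x where x: "\<And>l. x l \<in> V l" "\<And>l. x l \<in> F" by (metis IntD1 IntD2)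
  \<comment> \<open>\<open>pre s n\<close> is the node reached by the first \<open>n\<close> choices
    of the branch \<open>s\<close>; the reversal puts the last choice at the head.\<close>
  define pre where "pre s n = rev (map s [0..<n])" for s :: "nat \<Rightarrow> bool" and n
  have pre_Suc: "pre s (Suc n) = s n # pre s n" for s n by (simp add: pre_def)
  have "V (pre s (Suc n)) \<subseteq> V (pre s n)" for s n
    using split[OF good[of "pre s n"]] by (simp add: V_def pre_Suc splits_def)
  then have V_anti: "V (pre s m) \<subseteq> V (pre s n)" if "n \<le> m" for s m n
    using that by (rule lift_Suc_antimono_le)
  let ?Y = "subtopology ?w F"
  have "\<exists>z. z \<in> (\<Inter>n. ?Y closure_of (x ` pre s ` {n..}))" for s
  proof -
    have "(\<Inter>n. ?Y closure_of (x ` pre s ` {n..})) \<noteq> {}"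
    proof (rule compact_space_imp_nest)
      show "compact_space ?Y" using F by (simp add: compact_space_subtopology)
      show "?Y closure_of (x ` pre s ` {n..}) \<noteq> {}" for n
        using x(2) closure_of_subset[of "x ` pre s ` {n..}" ?Y] by auto
      show "decseq (\<lambda>n. ?Y closure_of (x ` pre s ` {n..}))"
        by (intro decseq_SucI closure_of_mono image_mono) auto
    qed simp
    then show ?thesis by blast
  qed
  then obtain z where z: "\<And>s n. z s \<in> ?Y closure_of (x ` pre s ` {n..})"
    by (metis INT_iff UNIV_I)
  \<comment> \<open>This is how the cluster points are used: a weakly closed condition that holds
    along the branch from some level on passes to \<open>z s\<close>.\<close>
  have z_closed: "z s \<in> G" if "closedin ?w G" "\<And>m. m \<ge> n \<Longrightarrow> x (pre s m) \<in> G" for s G n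
  proof -
    have "closedin ?Y (G \<inter> F)" using that(1) by (auto simp: closedin_subtopology)
    then have "?Y closure_of (x ` pre s ` {n..}) \<subseteq> G \<inter> F"
      using that(2) x(2) by (intro closure_of_minimal) auto
    then show ?thesis using z by blast
  qed
  \<comment> \<open>From level \<open>Suc n\<close> on the branches stay in different children of
    one node, so the functional of that node differs by at least \<open>e\<close> at the two cluster
    points, and \<open>p\<close> dominates it.\<close>
  have sep1: "e \<le> p (z s - z t)" if "s n" "\<not> t n" "pre s n = pre t n" for s t n
  proof -
    define l where "l = pre s n"
    have sp: "splits (V l) (f (V l)) (a (V l)) (c0 (V l)) (c1 (V l))" by (rule split[OF good])
    have cont: "continuous_map ?w euclideanreal (f (V l))" and lin: "linear (f (V l))"
      and fp: "f (V l) x \<le> p x" for x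
      using sp by (auto simp: splits_def)
    have "V (pre s (Suc n)) = c0 (V l)" using that by (simp add: pre_Suc V_def l_def)
    then have "x (pre s m) \<in> c0 (V l)" if "m \<ge> Suc n" for m
      using x(1) V_anti[OF that] by blast
    then have s: "z s \<in> {v \<in> topspace ?w. f (V l) v \<in> {a (V l) + e..}}"
      using sp by (intro z_closed[of _ "Suc n"] closedin_continuous_map_preimage[OF cont])
        (auto simp: splits_def)
    have "V (pre t (Suc n)) = c1 (V l)" using that by (simp add: pre_Suc V_def l_def)
    then have "x (pre t m) \<in> c1 (V l)" if "m \<ge> Suc n" for m
      using x(1) V_anti[OF that] by blast
    then have t: "z t \<in> {v \<in> topspace ?w. f (V l) v \<in> {..a (V l)}}"
      using sp by (intro z_closed[of _ "Suc n"] closedin_continuous_map_preimage[OF cont])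
        (auto simp: splits_def)
    show ?thesis using s t fp[of "z s - z t"] by (simp add: linear_diff[OF lin])
  qed
  have sep: "e \<le> p (z s - z t)" if "s \<noteq> t" for s t
  proof -
    have "\<exists>n. s n \<noteq> t n" using that by auto
    then have "\<exists>n. s n \<noteq> t n \<and> (\<forall>m<n. \<not> s m \<noteq> t m)"
      by (subst (asm) exists_least_iff)
    then obtain n where n: "s n \<noteq> t n" "\<And>m. m < n \<Longrightarrow> s m = t m" by blast
    then have "pre s n = pre t n" by (simp add: pre_def)
    then show ?thesis
      using n(1) sep1[of s n t] sep1[of t n s] seminorm_commute[OF p, of "z s" "z t"]
      by (cases "s n") auto
  qed
  define D where "D l = (\<Sum>(r, i)\<leftarrow>l. real_of_rat r *\<^sub>R x i)" for l
  have "\<exists>l. p (z s - D l) < e / 2" for s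
  proof -
    have "\<exists>v\<in>span (range x). p (z s - v) < e / 4"
    proof (rule weakly_dense_span_dense[OF Q])
      fix g :: "'x \<Rightarrow> real"
      assume g: "continuous_map ?w euclideanreal g" "\<And>v. v \<in> range x \<Longrightarrow> g v = 0"
      \<comment> \<open>The zero set of \<open>g\<close> is weakly closed, so a functional killing
        all node points also kills their cluster points.\<close>
      have "z s \<in> {v \<in> topspace ?w. g v \<in> {0}}"
        using g(2) by (intro z_closed[of _ 0] closedin_continuous_map_preimage[OF g(1)]) auto
      then show "g (z s) = 0" by simp
    qed (use e in auto)
    then obtain v where v: "v \<in> span (range x)" "p (z s - v) < e / 4" by blast
    obtain l where "p (v - D l) < e / 4"
      using span_rational_approximation[OF p v(1), of "e / 4"] e by (auto simp: D_def)
    then have "p (z s - D l) < e / 2" using v(2) seminorm_triangle[OF p, of "z s" "D l" v] by simp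
    then show ?thesis by blast
  qed
  then obtain l where l: "\<And>s. p (z s - D (l s)) < e / 2" by metis
  \<comment> \<open>Two branches with the same list would have \<open>p\<close>-distance below
    \<open>e\<close>. Thus \<open>l\<close> injects the set of all branches into a countable type,
    which Cantor's diagonal excludes.\<close>
  have "inj l"
  proof (rule injI, rule ccontr)
    fix s t assume "l s = l t" "s \<noteq> t"
    then show False
      using sep[of s t] l[of s] l[of t] seminorm_triangle[OF p, of "z s" "z t" "D (l s)"]
        seminorm_commute[OF p, of "z t" "D (l s)"] by simp
  qed
  then have "countable (UNIV :: (nat \<Rightarrow> bool) set)"
    using countableI[of "to_nat \<circ> l" UNIV] by (simp add: inj_compose)
  then obtain h :: "nat \<Rightarrow> nat \<Rightarrow> bool" where "range h = UNIV"
    by (metis UNIV_not_empty range_from_nat_into)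
  then obtain n where "h n = (\<lambda>m. \<not> h m m)" by (metis UNIV_I imageE)
  then show False by (metis (full_types))
qed

section \<open>Invariant means on compact systems\<close>

lemma bounded_continuous_map_compact_space:
  assumes "compact_space X" "continuous_map X euclideanreal f"
  obtains B where "B > 0" "\<And>x. x \<in> topspace X \<Longrightarrow> \<bar>f x\<bar> \<le> B"
proof -
  have "compact (f ` topspace X)"
    using image_compactin[of X "topspace X" euclideanreal f] assms by (simp add: compact_space_def)
  then obtain B where "B > 0" "\<And>y. y \<in> f ` topspace X \<Longrightarrow> norm y \<le> B"
    using compact_imp_bounded bounded_pos by metis
  then show thesis using that by auto
qed

text \<open>Here joint continuity enters. The function f (act s x) - f (act s0 x) vanishes at
  \<open>s = s0\<close> for all \<open>x\<close>, so by the tube lemma it is small near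
  \<open>s0\<close> uniformly over the compact space. The points \<open>x = act t x0\<close> then
  give an estimate uniform in \<open>t\<close>, that is, in the supremum norm.\<close>

lemma orbit_function_LUC:
  fixes act :: "'s::semitopological_semigroup \<Rightarrow> 'x \<Rightarrow> 'x"
  assumes sys: "continuous_dynamical_system X act" and X: "compact_space X"
    and x0: "x0 \<in> topspace X" and f: "continuous_map X euclideanreal f"
  shows "(\<lambda>s. complex_of_real (f (act s x0))) \<in> LUC"
proof -
  let ?g = "\<lambda>s. complex_of_real (f (act s x0))"
  have act_in: "act s x \<in> topspace X"
    and act_act: "act s (act t x) = act (s * t) x" if "x \<in> topspace X" for s t x
    using sys that by (auto simp: continuous_dynamical_system_def dynamical_system_def)
  have orbit: "continuous_map euclidean X (\<lambda>s. act s x0)"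
    and joint: "continuous_map (prod_topology euclidean X) X (\<lambda>(s, x). act s x)"
    using sys x0 by (auto simp: continuous_dynamical_system_def dynamical_system_def)
  obtain B where B: "\<And>x. x \<in> topspace X \<Longrightarrow> \<bar>f x\<bar> \<le> B"
    using bounded_continuous_map_compact_space[OF X f] by blast
  have "continuous_on UNIV (\<lambda>s. f (act s x0))"
    using continuous_map_compose[OF orbit f] by (simp add: o_def)
  then have g: "?g \<in> bcontfun"
    using B[OF act_in[OF x0]] by (auto simp: bcontfun_def bounded_iff intro!: continuous_on_of_real)
  have H: "continuous_map (prod_topology euclidean X) euclideanreal (\<lambda>(s, x). f (act s x))"
    using continuous_map_compose[OF joint f] by (simp add: o_def case_prod_unfold)
  have "((\<lambda>s. Bcontfun (left_translate s ?g)) \<longlongrightarrow> Bcontfun (left_translate s0 ?g)) (at s0)" for s0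
  proof (rule tendstoI)
    fix e :: real assume e: "e > 0"
    have "continuous_map (prod_topology euclidean X) X ((\<lambda>x. act s0 x) \<circ> snd)"
      using sys by (intro continuous_map_compose[OF continuous_map_snd])
        (auto simp: continuous_dynamical_system_def dynamical_system_def)
    then have "continuous_map (prod_topology euclidean X) euclideanreal (\<lambda>(s, x). f (act s0 x))"
      using continuous_map_compose[OF _ f] by (fastforce simp: o_def case_prod_unfold)
    with H have "continuous_map (prod_topology euclidean X) euclideanreal
        (\<lambda>(s, x). f (act s x) - f (act s0 x))"
      by (auto simp: case_prod_unfold intro: continuous_map_diff)
    then have "openin (prod_topology euclidean X) {z \<in> topspace (prod_topology euclidean X).
        (\<lambda>(s, x). f (act s x) - f (act s0 x)) z \<in> {- e / 2<..<e / 2}}" (is "openin _ ?W")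
      by (rule openin_continuous_map_preimage) simp
    moreover have "{s0} \<times> topspace X \<subseteq> ?W" using e by auto
    ultimately obtain U V where U: "open U" "s0 \<in> U" and V: "topspace X \<subseteq> V" "U \<times> V \<subseteq> ?W"
      using tube_lemma_right[of euclidean X ?W "topspace X" s0] X by (auto simp: compact_space_def)
    have "dist (Bcontfun (left_translate s ?g)) (Bcontfun (left_translate s0 ?g)) < e" if "s \<in> U" for s
    proof -
      have "dist (Bcontfun (left_translate s ?g)) (Bcontfun (left_translate s0 ?g)) \<le> e / 2"
      proof (rule dist_bound)
        fix t
        have "(s, act t x0) \<in> ?W" using V that act_in[OF x0, of t] by blast
        then have "(\<lambda>(s, x). f (act s x) - f (act s0 x)) (s, act t x0) \<in> {- e / 2<..<e / 2}"
          by blast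
        then have "\<bar>f (act (s * t) x0) - f (act (s0 * t) x0)\<bar> \<le> e / 2"
          unfolding prod.case act_act[OF x0] greaterThanLessThan_iff by linarith
        then show "dist (apply_bcontfun (Bcontfun (left_translate s ?g)) t)
            (apply_bcontfun (Bcontfun (left_translate s0 ?g)) t) \<le> e / 2"
          using left_translate_bcontfun[OF g]
          by (simp add: Bcontfun_inverse) (simp add: left_translate_def dist_norm flip: of_real_diff)
      qed
      then show ?thesis using e by simp
    qed
    then show "\<forall>\<^sub>F s in at s0. dist (Bcontfun (left_translate s ?g)) (Bcontfun (left_translate s0 ?g)) < e"
      unfolding eventually_at_topological using U by blast
  qed
  then have "continuous_on UNIV (\<lambda>s. Bcontfun (left_translate s ?g))"
    by (simp add: continuous_on_def)
  then show ?thesis using g by (simp add: LUC_def)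
qed

text \<open>Positivity on real functions takes the place of the norm condition. \<open>M\<close> is
  total, but only its values on continuous functions are constrained.\<close>

definition invariant_mean :: "'x topology \<Rightarrow> ('s \<Rightarrow> 'x \<Rightarrow> 'x) \<Rightarrow> (('x \<Rightarrow> real) \<Rightarrow> real) \<Rightarrow> bool"
  where "invariant_mean X act M \<longleftrightarrow>
    (\<forall>f g. continuous_map X euclideanreal f \<longrightarrow> continuous_map X euclideanreal g \<longrightarrow>
      M (\<lambda>x. f x + g x) = M f + M g) \<and>
    (\<forall>c f. continuous_map X euclideanreal f \<longrightarrow> M (\<lambda>x. c * f x) = c * M f) \<and>
    (\<forall>f. continuous_map X euclideanreal f \<longrightarrow> (\<forall>x\<in>topspace X. 0 \<le> f x) \<longrightarrow> 0 \<le> M f) \<and>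
    M (\<lambda>_. 1) = 1 \<and>
    (\<forall>s f. continuous_map X euclideanreal f \<longrightarrow> M (\<lambda>x. f (act s x)) = M f)"

text \<open>The supremum in \<open>dual_norm\<close> dominates the individual values only if these
  are bounded above; the constant from \<open>in_dual\<close> supplies such a bound.\<close>

lemma left_invariant_mean_le_1:
  fixes \<mu> :: "(('s::semitopological_semigroup \<Rightarrow> complex) \<Rightarrow> complex)"
  assumes \<mu>: "left_invariant_mean LUC \<mu>" and h: "h \<in> LUC" "\<And>t. cmod (h t) \<le> 1"
  shows "cmod (\<mu> h) \<le> 1"
proof -
  obtain B where B: "\<And>f. f \<in> LUC \<Longrightarrow> cmod (\<mu> f) \<le> B * sup_norm f"
    using \<mu> unfolding left_invariant_mean_def in_dual_def by blast
  have nonneg: "0 \<le> sup_norm f" if f: "f \<in> LUC" for f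
  proof -
    have "bounded (range f)" using f by (simp add: LUC_def bcontfun_def)
    then obtain b where "\<And>t. cmod (f t) \<le> b" by (auto simp: bounded_iff)
    then have "bdd_above (range (\<lambda>t. cmod (f t)))" by (intro bdd_aboveI2)
    then have "cmod (f undefined) \<le> sup_norm f"
      unfolding sup_norm_def by (intro cSUP_upper) auto
    then show ?thesis using norm_ge_zero order_trans by blast
  qed
  have "cmod (\<mu> f) \<le> \<bar>B\<bar>" if "f \<in> LUC" "sup_norm f \<le> 1" for f
  proof -
    have "B * sup_norm f \<le> \<bar>B\<bar> * sup_norm f" using nonneg[OF that(1)] by (intro mult_right_mono) auto
    also have "\<dots> \<le> \<bar>B\<bar> * 1" using that by (intro mult_left_mono) auto
    finally show ?thesis using B[OF that(1)] by simp
  qed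
  then have bdd: "bdd_above ((\<lambda>f. cmod (\<mu> f)) ` {f \<in> LUC. sup_norm f \<le> 1})"
    by (auto intro!: bdd_aboveI2)
  have "sup_norm h \<le> 1" unfolding sup_norm_def using h by (intro cSUP_least) auto
  then have "cmod (\<mu> h) \<le> dual_norm LUC \<mu>"
    unfolding dual_norm_def using h bdd by (intro cSUP_upper) auto
  then show ?thesis using \<mu> by (simp add: left_invariant_mean_def)
qed

text \<open>The mean is pulled back along the orbit map of \<open>x0\<close>: composing
  \<open>f\<close> with \<open>act s\<close> becomes left translation by \<open>s\<close> of the
  orbit function.\<close>

lemma exists_invariant_mean:
  fixes act :: "'s::semitopological_semigroup \<Rightarrow> 'x \<Rightarrow> 'x"
  assumes \<mu>: "left_invariant_mean (LUC :: ('s \<Rightarrow> complex) set) \<mu>"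
    and sys: "continuous_dynamical_system X act" and X: "compact_space X"
    and x0: "x0 \<in> topspace X"
  shows "\<exists>M. invariant_mean X act M"
proof -
  define o_fun where "o_fun f = (\<lambda>s. complex_of_real (f (act s x0)))" for f
  define M where "M f = Re (\<mu> (o_fun f))" for f
  have LUC: "o_fun f \<in> LUC" if "continuous_map X euclideanreal f" for f
    unfolding o_fun_def by (rule orbit_function_LUC[OF sys X x0 that])
  have add: "M (\<lambda>x. f x + g x) = M f + M g"
    if "continuous_map X euclideanreal f" "continuous_map X euclideanreal g" for f g
  proof -
    have "\<mu> (\<lambda>t. o_fun f t + o_fun g t) = \<mu> (o_fun f) + \<mu> (o_fun g)"
      using \<mu> LUC that by (simp add: left_invariant_mean_def in_dual_def)
    moreover have "o_fun (\<lambda>x. f x + g x) = (\<lambda>t. o_fun f t + o_fun g t)"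
      by (simp add: o_fun_def)
    ultimately show ?thesis by (simp add: M_def)
  qed
  have scale: "M (\<lambda>x. c * f x) = c * M f" if "continuous_map X euclideanreal f" for c f
  proof -
    have "\<mu> (\<lambda>t. complex_of_real c * o_fun f t) = complex_of_real c * \<mu> (o_fun f)"
      using \<mu> LUC that by (simp add: left_invariant_mean_def in_dual_def)
    moreover have "o_fun (\<lambda>x. c * f x) = (\<lambda>t. complex_of_real c * o_fun f t)"
      by (simp add: o_fun_def)
    ultimately show ?thesis by (simp add: M_def)
  qed
  have one: "M (\<lambda>_. 1) = 1" using \<mu> by (simp add: M_def o_fun_def left_invariant_mean_def)
  have act_in: "act s x0 \<in> topspace X" for s
    using sys x0 by (auto simp: continuous_dynamical_system_def dynamical_system_def)
  have pos: "0 \<le> M f" if f: "continuous_map X euclideanreal f" "\<forall>x\<in>topspace X. 0 \<le> f x" for f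
  proof -
    obtain B where B: "B > 0" "\<And>x. x \<in> topspace X \<Longrightarrow> \<bar>f x\<bar> \<le> B"
      using bounded_continuous_map_compact_space[OF X f(1)] by blast
    \<comment> \<open>For 0 \<le> f \<le> B the function 1 - f / B has values in [0, 1], so norm one
      of the mean gives 1 - M f / B \<le> 1, which is positivity.\<close>
    let ?h = "\<lambda>x. 1 + (- 1 / B) * f x"
    have c: "continuous_map X euclideanreal (\<lambda>x. (- 1 / B) * f x)"
      using f by (intro continuous_map_real_mult) auto
    then have h: "continuous_map X euclideanreal ?h" by (intro continuous_map_add) auto
    have "cmod (o_fun ?h t) \<le> 1" for t
    proof -
      have "0 \<le> f (act t x0) / B" "f (act t x0) / B \<le> 1"
        using f(2) B act_in[of t] by (auto simp: field_simps)
      then have "\<bar>?h (act t x0)\<bar> \<le> 1" by simp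
      then show ?thesis unfolding o_fun_def norm_of_real .
    qed
    then have "cmod (\<mu> (o_fun ?h)) \<le> 1" by (intro left_invariant_mean_le_1[OF \<mu> LUC[OF h]])
    then have "M ?h \<le> 1" unfolding M_def using complex_Re_le_cmod order_trans by blast
    have "M ?h = M (\<lambda>_. 1) + M (\<lambda>x. (- 1 / B) * f x)" by (rule add[OF _ c]) simp
    then have "M ?h = 1 + (- 1 / B) * M f" by (simp only: scale[OF f(1)] one)
    with \<open>M ?h \<le> 1\<close> have "1 + (- 1 / B) * M f \<le> 1" by (simp only:)
    then show ?thesis using B(1) by (simp add: zero_le_divide_iff)
  qed
  have "M (\<lambda>x. f (act s x)) = M f" if f: "continuous_map X euclideanreal f" for s f
  proof -
    have "o_fun (\<lambda>x. f (act s x)) = left_translate s (o_fun f)"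
      using sys x0 by (auto simp: o_fun_def left_translate_def continuous_dynamical_system_def
          dynamical_system_def)
    then show ?thesis using \<mu> LUC[OF f] by (simp add: M_def left_invariant_mean_def)
  qed
  then have "invariant_mean X act M"
    using add scale pos one by (simp add: invariant_mean_def)
  then show ?thesis by blast
qed

text \<open>By induction: a Urysohn function \<open>k\<close> for the new set vanishes on the old
  ones, and damping the old bumps by \<open>1 - k\<close> keeps the sum at most k + (1 - k) =
  1.\<close>

lemma disjoint_closed_bumps:
  assumes X: "normal_space X" and "finite I"
    and "\<And>i. i \<in> I \<Longrightarrow> closedin X (C i)"
    and "\<And>i j. i \<in> I \<Longrightarrow> j \<in> I \<Longrightarrow> i \<noteq> j \<Longrightarrow> C i \<inter> C j = {}"
  shows "\<exists>g. (\<forall>i\<in>I. continuous_map X euclideanreal (g i) \<and> (\<forall>x\<in>topspace X. 0 \<le> g i x) \<and>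
      (\<forall>x\<in>C i. g i x = (1::real))) \<and> (\<forall>x\<in>topspace X. (\<Sum>i\<in>I. g i x) \<le> 1)"
  using assms(2-)
proof (induction I rule: finite_induct)
  case empty
  then show ?case by simp
next
  case (insert a I)
  have "\<exists>g. (\<forall>i\<in>I. continuous_map X euclideanreal (g i) \<and> (\<forall>x\<in>topspace X. 0 \<le> g i x) \<and>
      (\<forall>x\<in>C i. g i x = (1::real))) \<and> (\<forall>x\<in>topspace X. (\<Sum>i\<in>I. g i x) \<le> 1)"
    by (rule insert.IH) (use insert.prems in auto)
  then obtain g where "\<forall>i\<in>I. continuous_map X euclideanreal (g i) \<and>
      (\<forall>x\<in>topspace X. 0 \<le> g i x) \<and> (\<forall>x\<in>C i. g i x = (1::real))"
    "\<forall>x\<in>topspace X. (\<Sum>i\<in>I. g i x) \<le> 1"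
    by auto
  then have g: "\<And>i. i \<in> I \<Longrightarrow> continuous_map X euclideanreal (g i)"
    "\<And>i x. i \<in> I \<Longrightarrow> x \<in> topspace X \<Longrightarrow> 0 \<le> g i x" "\<And>i x. i \<in> I \<Longrightarrow> x \<in> C i \<Longrightarrow> g i x = 1"
    "\<And>x. x \<in> topspace X \<Longrightarrow> (\<Sum>i\<in>I. g i x) \<le> 1"
    by blast+
  have "closedin X (\<Union>i\<in>I. C i)" using insert by (intro closedin_Union) auto
  moreover have "C i \<inter> C a = {}" if "i \<in> I" for i
    using insert.prems(2)[of i a] insert.hyps that by auto
  then have "disjnt (\<Union>i\<in>I. C i) (C a)" by (auto simp: disjnt_def)
  ultimately obtain k where k: "continuous_map X (top_of_set {0..1::real}) k"
    "k ` (\<Union>i\<in>I. C i) \<subseteq> {0}" "k ` C a \<subseteq> {1}"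
    using Urysohn_lemma[OF X, of "\<Union>i\<in>I. C i" "C a" 0 1] insert.prems(1) by auto
  have k01: "0 \<le> k x" "k x \<le> 1" if "x \<in> topspace X" for x
    using k(1) that by (auto simp: continuous_map_in_subtopology)
  define g' where "g' i = (if i = a then k else (\<lambda>x. (1 - k x) * g i x))" for i
  have kc: "continuous_map X euclideanreal k" using k(1) by (simp add: continuous_map_in_subtopology)
  have "continuous_map X euclideanreal (g' i)" if "i \<in> insert a I" for i
    using that g(1) kc by (auto simp: g'_def intro!: continuous_map_real_mult continuous_map_diff)
  moreover have "0 \<le> g' i x" if "i \<in> insert a I" "x \<in> topspace X" for i x
    using that g(2) k01 by (auto simp: g'_def)
  moreover have "g' i x = 1" if "i \<in> insert a I" "x \<in> C i" for i x
    using that g(3) k(2,3) by (auto simp: g'_def image_subset_iff)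
  moreover have "(\<Sum>i\<in>insert a I. g' i x) \<le> 1" if x: "x \<in> topspace X" for x
  proof -
    have "(\<Sum>i\<in>I. g' i x) = (\<Sum>i\<in>I. (1 - k x) * g i x)"
      using insert.hyps by (intro sum.cong) (auto simp: g'_def)
    also have "\<dots> \<le> (1 - k x) * 1"
      unfolding sum_distrib_left[symmetric] using g(4) k01 x by (intro mult_left_mono) auto
    finally show ?thesis using insert.hyps by (simp add: g'_def)
  qed
  ultimately show ?case by (intro exI[of _ g']) blast
qed

section \<open>Strictly positive means on minimal compact systems\<close>

locale minimal_mean =
  fixes X :: "'x topology" and act :: "'s \<Rightarrow> 'x \<Rightarrow> 'x" and M :: "('x \<Rightarrow> real) \<Rightarrow> real"
  assumes compact: "compact_space X" and Hausdorff: "Hausdorff_space X"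
    and act_cont: "continuous_map X X (act s)"
    and mean: "invariant_mean X act M"
    and minimal: "x \<in> topspace X \<Longrightarrow> openin X W \<Longrightarrow> W \<noteq> {} \<Longrightarrow> \<exists>s. act s x \<in> W"
begin

lemma normal: "normal_space X"
  using compact Hausdorff by (simp add: compact_Hausdorff_or_regular_imp_normal_space)

lemma act_in: "x \<in> topspace X \<Longrightarrow> act s x \<in> topspace X"
  using act_cont[of s] by (auto simp: continuous_map_def)

lemma cont_act: "continuous_map X euclideanreal f \<Longrightarrow> continuous_map X euclideanreal (\<lambda>x. f (act s x))"
  using continuous_map_compose[OF act_cont] by (fastforce simp: o_def)

lemma mean_add: "continuous_map X euclideanreal f \<Longrightarrow> continuous_map X euclideanreal g \<Longrightarrow>
    M (\<lambda>x. f x + g x) = M f + M g"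
  and mean_scale: "continuous_map X euclideanreal f \<Longrightarrow> M (\<lambda>x. c * f x) = c * M f"
  and mean_nonneg: "continuous_map X euclideanreal f \<Longrightarrow> (\<And>x. x \<in> topspace X \<Longrightarrow> 0 \<le> f x) \<Longrightarrow> 0 \<le> M f"
  and mean_one: "M (\<lambda>_. 1) = 1"
  and mean_act: "continuous_map X euclideanreal f \<Longrightarrow> M (\<lambda>x. f (act s x)) = M f"
  using mean by (auto simp: invariant_mean_def)

lemma mean_mono:
  assumes f: "continuous_map X euclideanreal f" and g: "continuous_map X euclideanreal g"
    and le: "\<And>x. x \<in> topspace X \<Longrightarrow> f x \<le> g x"
  shows "M f \<le> M g"
proof -
  have c: "continuous_map X euclideanreal (\<lambda>x. g x - f x)" by (intro continuous_map_diff f g)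
  then have "0 \<le> M (\<lambda>x. g x - f x)" using le by (intro mean_nonneg) auto
  moreover have "M g = M f + M (\<lambda>x. g x - f x)" using mean_add[OF f c] by simp
  ultimately show ?thesis by simp
qed

lemma mean_const: "M (\<lambda>_. c) = c"
  using mean_scale[of "\<lambda>_. 1" c] mean_one by simp

lemma mean_sum:
  assumes "finite I" "\<And>i. i \<in> I \<Longrightarrow> continuous_map X euclideanreal (f i)"
  shows "M (\<lambda>x. \<Sum>i\<in>I. f i x) = (\<Sum>i\<in>I. M (f i))"
  using assms
proof (induction I rule: finite_induct)
  case empty
  then show ?case using mean_const[of 0] by simp
next
  case (insert a I)
  then have "M (\<lambda>x. f a x + (\<Sum>i\<in>I. f i x)) = M (f a) + M (\<lambda>x. \<Sum>i\<in>I. f i x)"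
    by (intro mean_add continuous_map_sum) auto
  then show ?case using insert by simp
qed

text \<open>Every orbit meets the open set where \<open>f\<close> is positive, so by compactness
  finitely many preimages of it under the action cover the space. The sum of the corresponding
  translates of \<open>f\<close> has a positive minimum, and by invariance its mean is a multiple of
  \<open>M f\<close>.\<close>

lemma mean_pos:
  assumes f: "continuous_map X euclideanreal f" "\<And>x. x \<in> topspace X \<Longrightarrow> 0 \<le> f x"
    and u: "u \<in> topspace X" "0 < f u"
  shows "0 < M f"
proof -
  define W where "W s = {x \<in> topspace X. f (act s x) \<in> {0<..}}" for s
  have open_W: "openin X (W s)" for s
    unfolding W_def by (rule openin_continuous_map_preimage[OF cont_act[OF f(1)]]) simp
  have "openin X {x \<in> topspace X. f x \<in> {0<..}}"
    by (rule openin_continuous_map_preimage[OF f(1)]) simp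
  then have "\<exists>s. x \<in> W s" if "x \<in> topspace X" for x
    using minimal[OF that, of "{x \<in> topspace X. f x \<in> {0<..}}"] u that by (auto simp: W_def)
  then have "topspace X \<subseteq> \<Union> (range W)" by blast
  then obtain \<F> where \<F>: "finite \<F>" "\<F> \<subseteq> range W" "topspace X \<subseteq> \<Union>\<F>"
    using compact open_W unfolding compact_space_alt by (metis imageE)
  then obtain I where I: "finite I" "\<F> = W ` I" by (meson finite_subset_image)
  define g where "g x = (\<Sum>s\<in>I. f (act s x))" for x
  have g: "continuous_map X euclideanreal g"
    unfolding g_def using I cont_act[OF f(1)] by (intro continuous_map_sum) auto
  have g_pos: "0 < g x" if x: "x \<in> topspace X" for x
  proof -
    obtain s where "s \<in> I" "x \<in> W s" using \<F>(3) I x by blast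
    then show ?thesis
      unfolding g_def using I f(2) act_in[OF x] by (intro sum_pos2[of I s]) (auto simp: W_def)
  qed
  have "compact (g ` topspace X)"
    using image_compactin[of X "topspace X" euclideanreal g] compact g by (simp add: compact_space_def)
  then obtain c where c: "c \<in> g ` topspace X" "\<And>y. y \<in> g ` topspace X \<Longrightarrow> c \<le> y"
    using compact_attains_inf[of "g ` topspace X"] u by blast
  then have "0 < c" using g_pos by auto
  also have "c \<le> M g" using mean_mono[OF _ g, of "\<lambda>_. c"] c(2) mean_const[of c] by simp
  also have "M g = real (card I) * M f"
    unfolding g_def using mean_sum[OF I(1), of "\<lambda>s x. f (act s x)"] cont_act[OF f(1)] mean_act[OF f(1)]
    by simp
  finally show ?thesis using zero_less_mult_pos by (metis of_nat_0_le_iff order_le_less mult_zero_left less_irrefl)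
qed

text \<open>If the compact image missed \<open>u\<close>, a Urysohn function vanishing on the image
  and equal to 1 at \<open>u\<close> would have positive mean, while its composition with
  \<open>act s\<close> has mean at most 0.\<close>

lemma act_surj: "act s ` topspace X = topspace X"
proof
  show "act s ` topspace X \<subseteq> topspace X" using act_in by auto
  show "topspace X \<subseteq> act s ` topspace X"
  proof (rule ccontr)
    assume "\<not> topspace X \<subseteq> act s ` topspace X"
    then obtain u where u: "u \<in> topspace X" "u \<notin> act s ` topspace X" by blast
    have "compactin X (act s ` topspace X)"
      using compact by (intro image_compactin[OF _ act_cont]) (simp add: compact_space_def)
    then have "closedin X (act s ` topspace X)" by (rule compactin_imp_closedin[OF Hausdorff])
    moreover have "closedin X {u}"
      using u Hausdorff by (simp add: Hausdorff_imp_t1_space closedin_t1_singleton)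
    ultimately obtain k where k: "continuous_map X (top_of_set {0..1::real}) k"
      "k ` act s ` topspace X \<subseteq> {0}" "k ` {u} \<subseteq> {1}"
      using Urysohn_lemma[OF normal, of "act s ` topspace X" "{u}" 0 1] u(2) by (auto simp: disjnt_def)
    have kc: "continuous_map X euclideanreal k" using k(1) by (simp add: continuous_map_in_subtopology)
    have "0 < M k"
      using k kc u(1) by (intro mean_pos[of k u]) (auto simp: continuous_map_in_subtopology)
    moreover have "k (act s x) \<le> 0" if "x \<in> topspace X" for x
      using k(2) that unfolding image_image by (simp add: image_subset_iff)
    then have "M (\<lambda>x. k (act s x)) \<le> 0"
      using mean_mono[OF cont_act[OF kc], of "\<lambda>_. 0" s] mean_const[of 0] by simp
    ultimately show False using mean_act[OF kc, of s] by simp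
  qed
qed

text \<open>A packing argument. If \<open>y = act s u\<close> with \<open>u\<close> in
  \<open>W\<close>, then \<open>act s\<close> sends \<open>W\<close> into the closed
  \<open>e\<close>-ball around \<open>y\<close>, so a bump equal to 1 on this ball has at least the
  mean of a fixed function \<open>h\<close> vanishing outside \<open>W\<close>. The total mass 1
  bounds the number of disjoint balls.\<close>

lemma finite_net:
  fixes d :: "'x \<Rightarrow> 'x \<Rightarrow> real"
  assumes refl: "\<And>x. d x x = 0" and commute: "\<And>x y. d x y = d y x"
    and triangle: "\<And>x y z. d x z \<le> d x y + d y z"
    and ball: "\<And>y r. closedin X {x \<in> topspace X. d x y \<le> r}"
    and nonexp: "\<And>s x y. x \<in> topspace X \<Longrightarrow> y \<in> topspace X \<Longrightarrow> d (act s x) (act s y) \<le> d x y"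
    and W: "openin X W" "W \<noteq> {}" "\<And>x y. x \<in> W \<Longrightarrow> y \<in> W \<Longrightarrow> d x y \<le> e"
  shows "\<exists>N. finite N \<and> N \<subseteq> topspace X \<and> (\<forall>x\<in>topspace X. \<exists>y\<in>N. d x y \<le> 2 * e)"
proof -
  obtain u where u: "u \<in> W" using W by blast
  have uX: "u \<in> topspace X" using u W openin_subset by blast
  have "closedin X {u}" using uX Hausdorff by (simp add: Hausdorff_imp_t1_space closedin_t1_singleton)
  moreover have "closedin X (topspace X - W)" using W by blast
  ultimately obtain h where h: "continuous_map X (top_of_set {0..1::real}) h"
    "h ` (topspace X - W) \<subseteq> {0}" "h ` {u} \<subseteq> {1}"
    using Urysohn_lemma[OF normal, of "topspace X - W" "{u}" 0 1] u by (auto simp: disjnt_def)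
  have hc: "continuous_map X euclideanreal h" using h(1) by (simp add: continuous_map_in_subtopology)
  have h01: "0 \<le> h x" "h x \<le> 1" if "x \<in> topspace X" for x
    using h(1) that by (auto simp: continuous_map_in_subtopology)
  have Mh: "0 < M h" using h hc h01 uX by (intro mean_pos[of h u]) auto
  \<comment> \<open>Points more than \<open>2 * e\<close> apart have disjoint closed
    \<open>e\<close>-balls. They are taken from the orbit of \<open>u\<close> because the lower
    bound on the mass holds there.\<close>
  define sparse where "sparse N \<longleftrightarrow> finite N \<and> N \<subseteq> range (\<lambda>s. act s u) \<and>
    (\<forall>x\<in>N. \<forall>y\<in>N. x \<noteq> y \<longrightarrow> 2 * e < d x y)" for N
  have card_bound: "real (card N) * M h \<le> 1" if N: "sparse N" for N
  proof -
    define C where "C y = {x \<in> topspace X. d x y \<le> e}" for y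
    have "C x \<inter> C y = {}" if "x \<in> N" "y \<in> N" "x \<noteq> y" for x y
    proof -
      have "2 * e < d x y" using N that by (simp add: sparse_def)
      then have "\<not> (d z x \<le> e \<and> d z y \<le> e)" for z
        using triangle[of x y z] commute[of x z] by auto
      then show ?thesis by (auto simp: C_def)
    qed
    moreover have fin: "finite N" using N by (simp add: sparse_def)
    moreover have "closedin X (C y)" for y unfolding C_def by (rule ball)
    ultimately obtain g where "\<forall>y\<in>N. continuous_map X euclideanreal (g y) \<and>
        (\<forall>x\<in>topspace X. 0 \<le> g y x) \<and> (\<forall>x\<in>C y. g y x = (1::real))"
      "\<forall>x\<in>topspace X. (\<Sum>y\<in>N. g y x) \<le> 1"
      using disjoint_closed_bumps[OF normal, of N C] by auto
    then have g: "\<And>y. y \<in> N \<Longrightarrow> continuous_map X euclideanreal (g y)"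
      "\<And>y x. y \<in> N \<Longrightarrow> x \<in> topspace X \<Longrightarrow> 0 \<le> g y x"
      "\<And>y x. y \<in> N \<Longrightarrow> x \<in> C y \<Longrightarrow> g y x = (1::real)"
      "\<And>x. x \<in> topspace X \<Longrightarrow> (\<Sum>y\<in>N. g y x) \<le> 1"
      by blast+
    have "M h \<le> M (g y)" if y: "y \<in> N" for y
    proof -
      obtain s where s: "y = act s u" using N y by (auto simp: sparse_def)
      have "h x \<le> g y (act s x)" if x: "x \<in> topspace X" for x
      proof (cases "x \<in> W")
        case True
        then have "d (act s x) y \<le> e" using W(3)[of x u] u nonexp[OF x uX, of s] s by simp
        then have "g y (act s x) = 1" using g(3)[OF y] act_in[OF x] by (simp add: C_def)
        then show ?thesis using h01[OF x] by simp
      next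
        case False
        then have "h x = 0" using h(2) x by auto
        then show ?thesis using g(2)[OF y act_in[OF x]] by simp
      qed
      then have "M h \<le> M (\<lambda>x. g y (act s x))"
        by (intro mean_mono hc cont_act g(1) y)
      then show ?thesis using mean_act[OF g(1)[OF y]] by simp
    qed
    then have "(\<Sum>y\<in>N. M h) \<le> (\<Sum>y\<in>N. M (g y))" by (intro sum_mono)
    also have "\<dots> = M (\<lambda>x. \<Sum>y\<in>N. g y x)" using mean_sum[OF \<open>finite N\<close> g(1)] by simp
    also have "\<dots> \<le> M (\<lambda>_. 1)"
      using g(4) \<open>finite N\<close> by (intro mean_mono continuous_map_sum g(1)) auto
    finally show ?thesis using mean_one by simp
  qed
  have "card N \<le> nat \<lceil>1 / M h\<rceil>" if "sparse N" for N
  proof -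
    have "real (card N) \<le> 1 / M h" using card_bound[OF that] Mh by (simp add: field_simps)
    then show ?thesis by linarith
  qed
  moreover have "sparse {}" by (simp add: sparse_def)
  ultimately have "\<exists>N. sparse N \<and> (\<forall>N'. sparse N' \<longrightarrow> card N' \<le> card N)"
    by (intro ex_has_greatest_nat[of sparse "{}" card "Suc (nat \<lceil>1 / M h\<rceil>)"]) (auto simp: less_Suc_eq_le le_Suc_eq)
  then obtain N where N: "sparse N" and max: "\<And>N'. sparse N' \<Longrightarrow> card N' \<le> card N"
    by blast
  have fin: "finite N" and NX: "N \<subseteq> topspace X" using N act_in[OF uX] by (auto simp: sparse_def)
  have orbit: "\<exists>y\<in>N. d (act s u) y \<le> 2 * e" for s
  proof (rule ccontr)
    assume far: "\<not> ?thesis"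
    \<comment> \<open>This forces e \<ge> 0, so each point of \<open>N\<close> is within
      \<open>2 * e\<close> of itself and the far orbit point cannot lie in \<open>N\<close>.\<close>
    have "d u u \<le> e" using W(3)[OF u u] .
    then have "d (act s u) (act s u) \<le> 2 * e" using refl by simp
    then have new: "act s u \<notin> N" using far by blast
    have far': "2 * e < d (act s u) y" "2 * e < d y (act s u)" if "y \<in> N" for y
      using far that commute[of y "act s u"] by auto
    then have "sparse (insert (act s u) N)" using N by (simp add: sparse_def)
    from max[OF this] show False using new fin by simp
  qed
  have "\<exists>y\<in>N. d x y \<le> 2 * e" if x: "x \<in> topspace X" for x
  proof (rule ccontr)
    assume far: "\<not> ?thesis"
    \<comment> \<open>The orbit of \<open>u\<close> stays within \<open>2 * e\<close> of
      \<open>N\<close>, yet it would have to enter this nonempty complement of finitely many closed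
      balls.\<close>
    let ?V = "topspace X - (\<Union>y\<in>N. {x \<in> topspace X. d x y \<le> 2 * e})"
    have "closedin X (\<Union>y\<in>N. {x \<in> topspace X. d x y \<le> 2 * e})"
      using fin ball by (intro closedin_Union) auto
    then have "openin X ?V" by blast
    moreover have "x \<in> ?V" using far x by auto
    ultimately obtain s where "act s u \<in> ?V" using minimal[OF uX, of ?V] by blast
    then show False using orbit[of s] by auto
  qed
  then show ?thesis using fin NX by blast
qed

end

section \<open>The fixed point theorem\<close>

text \<open>Zorn's lemma for reverse inclusion. Nonempty finite subfamilies of a chain have their
  intersection in the chain, hence nonempty, and compactness extends this to the whole
  chain.\<close>

lemma minimal_closed_member:
  assumes X: "compact_space X" and "S0 \<in> \<S>"
    and closed: "\<And>S. S \<in> \<S> \<Longrightarrow> closedin X S" and ne: "{} \<notin> \<S>"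
    and Inter: "\<And>\<C>. \<C> \<subseteq> \<S> \<Longrightarrow> \<C> \<noteq> {} \<Longrightarrow> \<Inter>\<C> \<noteq> {} \<Longrightarrow> \<Inter>\<C> \<in> \<S>"
  obtains S where "S \<in> \<S>" "\<And>T. T \<in> \<S> \<Longrightarrow> T \<subseteq> S \<Longrightarrow> T = S"
proof -
  let ?P = "\<lambda>A B :: 'a set. B \<subseteq> A"
  have po: "partial_order_on \<S> (relation_of ?P \<S>)"
    by (rule partial_order_on_relation_ofI) auto
  have "\<exists>U\<in>\<S>. \<forall>A\<in>\<C>. U \<subseteq> A" if "\<C> \<in> Chains (relation_of ?P \<S>)" for \<C>
  proof (cases "\<C> = {}")
    case True
    then show ?thesis using assms(2) by auto
  next
    case False
    have sub: "\<C> \<subseteq> \<S>" and tot: "\<And>A B. A \<in> \<C> \<Longrightarrow> B \<in> \<C> \<Longrightarrow> A \<subseteq> B \<or> B \<subseteq> A"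
      using that by (auto simp: Chains_def relation_of_def)
    have fin: "\<Inter>\<F> \<in> \<C>" if "finite \<F>" "\<F> \<noteq> {}" "\<F> \<subseteq> \<C>" for \<F>
      using that
    proof (induction \<F> rule: finite_ne_induct)
      case (insert A \<F>)
      then have "A \<subseteq> \<Inter>\<F> \<or> \<Inter>\<F> \<subseteq> A" using tot by simp
      then show ?case using insert by (auto simp: Int_absorb1 Int_absorb2)
    qed simp
    have "\<Inter>\<F> \<noteq> {}" if "finite \<F>" "\<F> \<subseteq> \<C>" for \<F>
    proof (cases "\<F> = {}")
      case False
      then have "\<Inter>\<F> \<in> \<S>" using fin[OF that(1) _ that(2)] sub by blast
      then show ?thesis using ne by metis
    qed simp
    moreover have "closedin X A" if "A \<in> \<C>" for A using closed sub that by blast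
    ultimately have "\<Inter>\<C> \<noteq> {}"
      by (intro compact_space_fip[THEN iffD1, OF X, rule_format]) auto
    then have "\<Inter>\<C> \<in> \<S>" using Inter sub False by blast
    then show ?thesis by blast
  qed
  from predicate_Zorn[OF po this] show thesis using that by blast
qed

lemma continuous_dynamical_system_subtopology:
  assumes sys: "continuous_dynamical_system X act" and F: "F \<subseteq> topspace X"
    and inv: "\<And>s x. x \<in> F \<Longrightarrow> act s x \<in> F"
  shows "continuous_dynamical_system (subtopology X F) act"
proof -
  have top: "topspace (subtopology X F) = F" using F by auto
  have "continuous_map (prod_topology euclidean (subtopology X F)) (subtopology X F) (\<lambda>(s, x). act s x)"
    using sys F inv unfolding continuous_dynamical_system_def prod_topology_subtopology
    by (auto simp: continuous_map_in_subtopology intro!: continuous_map_from_subtopology)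
  moreover have "continuous_map (subtopology X F) (subtopology X F) (act s)" for s
    using sys F inv unfolding continuous_dynamical_system_def dynamical_system_def
    by (auto simp: continuous_map_in_subtopology intro!: continuous_map_from_subtopology)
  moreover have "continuous_map euclidean (subtopology X F) (\<lambda>s. act s x)" if "x \<in> F" for x
    using sys F inv that unfolding continuous_dynamical_system_def dynamical_system_def
    by (auto simp: continuous_map_in_subtopology)
  ultimately show ?thesis
    using sys F inv unfolding continuous_dynamical_system_def dynamical_system_def top
    by (auto simp: subset_iff)
qed

section \<open>Non-diametral points in convex hulls\<close>

lemma seminorm_sum:
  assumes "seminorm p" "finite I"
  shows "p (\<Sum>i\<in>I. f i) \<le> (\<Sum>i\<in>I. p (f i))"
  using assms(2)
proof (induction I rule: finite_induct)
  case (insert a I)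
  then show ?case using seminorm_add[OF assms(1), of "f a" "\<Sum>i\<in>I. f i"] by simp
qed (simp add: seminorm_zero[OF assms(1)])

lemma convex_seminorm_ball:
  assumes "seminorm p"
  shows "convex {y. p (y - x) \<le> r}"
proof (rule convexI)
  fix y z and u v :: real
  assume yz: "y \<in> {y. p (y - x) \<le> r}" "z \<in> {y. p (y - x) \<le> r}" and uv: "0 \<le> u" "0 \<le> v" "u + v = 1"
  have "(u *\<^sub>R y + v *\<^sub>R z) - x = u *\<^sub>R (y - x) + v *\<^sub>R (z - x)"
    using uv(3) by (simp add: algebra_simps flip: scaleR_add_left)
  then have "p ((u *\<^sub>R y + v *\<^sub>R z) - x) \<le> u * p (y - x) + v * p (z - x)"
    using seminorm_add[OF assms, of "u *\<^sub>R (y - x)" "v *\<^sub>R (z - x)"] uv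
    by (simp add: seminorm_scaleR[OF assms])
  also have "\<dots> \<le> u * r + v * r" using yz uv by (intro add_mono mult_left_mono) auto
  also have "\<dots> = r" using uv(3) by (simp flip: distrib_right)
  finally show "u *\<^sub>R y + v *\<^sub>R z \<in> {y. p (y - x) \<le> r}" by simp
qed

text \<open>The witness is the average of the net. A point of \<open>F\<close> is within half the
  diameter \<open>d\<close> of one of the \<open>n\<close> net points and within \<open>d\<close> of
  the others, hence within (d / 2 + (n - 1) d) / n = d - d / (2 n) < d of the average.\<close>

lemma finite_net_normal_structure:
  assumes p: "seminorm p" and N: "finite N" "N \<subseteq> F"
    and net: "\<And>x. x \<in> F \<Longrightarrow> \<exists>y\<in>N. p (x - y) \<le> p (a - b) / 2"
    and ab: "a \<in> F" "b \<in> F" "0 < p (a - b)"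
  shows "\<exists>y r. y \<in> convex hull F \<and> (\<forall>x\<in>F. p (y - x) \<le> r) \<and> (\<exists>x\<in>F. \<exists>x'\<in>F. r < p (x - x'))"
proof -
  define D where "D = (\<lambda>(x, x'). p (x - x')) ` (F \<times> F)"
  define d where "d = Sup D"
  have "bdd_above ((\<lambda>(y, y'). p (y - y')) ` (N \<times> N))" using N(1) by (intro bdd_above_finite) simp
  then obtain B where B: "\<And>y y'. y \<in> N \<Longrightarrow> y' \<in> N \<Longrightarrow> p (y - y') \<le> B"
    by (fastforce simp: bdd_above_def)
  \<comment> \<open>The finite net bounds the diameter, so that \<open>Sup D\<close> is a genuine
    supremum.\<close>
  have "p (x - x') \<le> p (a - b) + B" if x: "x \<in> F" "x' \<in> F" for x x'
  proof -
    obtain y y' where "y \<in> N" "p (x - y) \<le> p (a - b) / 2" "y' \<in> N" "p (x' - y') \<le> p (a - b) / 2"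
      using net x by meson
    then show ?thesis
      using B[of y y'] seminorm_triangle[OF p, of x x' y] seminorm_triangle[OF p, of y x' y']
        seminorm_commute[OF p, of x' y'] by simp
  qed
  then have bdd: "bdd_above D" by (auto simp: D_def bdd_above_def)
  have le_d: "p (x - x') \<le> d" if "x \<in> F" "x' \<in> F" for x x'
    unfolding d_def using that by (intro cSup_upper bdd) (auto simp: D_def)
  have "N \<noteq> {}" using net ab(1) by blast
  define n where "n = real (card N)"
  have n: "n > 0" using \<open>N \<noteq> {}\<close> N(1) by (simp add: n_def card_gt_0_iff)
  define y where "y = (\<Sum>v\<in>N. (1 / n) *\<^sub>R v)"
  define r where "r = d - d / (2 * n)"
  have "y \<in> convex hull F"
    unfolding y_def using N n hull_subset[of F convex]
    by (intro convex_sum convex_convex_hull) (auto simp: n_def)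
  moreover have "p (y - x) \<le> r" if x: "x \<in> F" for x
  proof -
    obtain v0 where v0: "v0 \<in> N" "p (x - v0) \<le> p (a - b) / 2" using net[OF x] by blast
    have "y - x = (\<Sum>v\<in>N. (1 / n) *\<^sub>R (v - x))"
      using n by (simp add: y_def scaleR_diff_right sum_subtractf n_def sum_constant_scaleR)
    then have "p (y - x) \<le> (\<Sum>v\<in>N. p ((1 / n) *\<^sub>R (v - x)))"
      using seminorm_sum[OF p N(1)] by simp
    also have "\<dots> = (1 / n) * (\<Sum>v\<in>N. p (v - x))"
      using n by (simp add: seminorm_scaleR[OF p] sum_distrib_left)
    also have "(\<Sum>v\<in>N. p (v - x)) = p (v0 - x) + (\<Sum>v\<in>N - {v0}. p (v - x))"
      using N(1) v0(1) by (rule sum.remove)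
    also have "\<dots> \<le> d / 2 + (\<Sum>v\<in>N - {v0}. d)"
      using v0 le_d[OF ab(1,2)] seminorm_commute[OF p, of v0 x] N(2) x
      by (intro add_mono sum_mono le_d) auto
    also have "\<dots> = d / 2 + (n - 1) * d"
      using N(1) v0(1) n by (simp add: n_def card_Diff_singleton of_nat_diff Suc_leI)
    finally show ?thesis using n by (simp add: r_def field_simps)
  qed
  moreover have "\<exists>x\<in>F. \<exists>x'\<in>F. r < p (x - x')"
  proof -
    have "0 < d" using le_d[OF ab(1,2)] ab(3) by simp
    then have "r < Sup D" using n by (simp add: r_def d_def)
    moreover have "D \<noteq> {}" using ab by (auto simp: D_def)
    ultimately obtain c where "c \<in> D" "r < c" using less_cSupE by blast
    then show ?thesis by (auto simp: D_def)
  qed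
  ultimately show ?thesis by blast
qed

theorem theorem3p4:
  fixes Q :: "('x::{real_vector, t2_space} \<Rightarrow> real) set"
    and K :: "'x set"
    and act :: "'s::semitopological_semigroup \<Rightarrow> 'x \<Rightarrow> 'x"
  assumes "\<exists>\<mu>. left_invariant_mean (LUC :: ('s \<Rightarrow> complex) set) \<mu>"
    and "topology_determined_by Q"
    and "K \<noteq> {}" and "compactin weak_topology K" and "convex K"
    and "continuous_dynamical_system (subtopology weak_topology K) act"
    and "nonexpansive_on Q K act"
  shows "\<exists>x\<in>K. \<forall>s. act s x = x"
proof -
  note Q = assms(2)
  let ?w = "weak_topology :: 'x topology"
  let ?K = "subtopology ?w K"
  have cK: "compact_space ?K" using assms(4) by (simp add: compact_space_subtopology)
  have act_in: "act s x \<in> K"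
    and act_act: "act s (act t x) = act (s * t) x" if "x \<in> K" for s t x
    using assms(6) that
    by (auto simp: continuous_dynamical_system_def dynamical_system_def)
  define \<K> where "\<K> = {S. closedin ?K S \<and> S \<noteq> {} \<and> convex S \<and> (\<forall>s. \<forall>x\<in>S. act s x \<in> S)}"
  have "K \<in> \<K>" using assms(3,5) act_in closedin_topspace[of ?K] by (simp add: \<K>_def)
  have "\<Inter>\<C> \<in> \<K>" if "\<C> \<subseteq> \<K>" "\<C> \<noteq> {}" "\<Inter>\<C> \<noteq> {}" for \<C>
  proof -
    have "closedin ?K (\<Inter>\<C>)" using that by (intro closedin_Inter) (auto simp: \<K>_def)
    moreover have "convex (\<Inter>\<C>)" using that by (intro convex_Inter) (auto simp: \<K>_def)
    ultimately show ?thesis using that by (auto simp: \<K>_def)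
  qed
  moreover have "closedin ?K S" if "S \<in> \<K>" for S using that by (simp add: \<K>_def)
  moreover have "{} \<notin> \<K>" by (simp add: \<K>_def)
  ultimately obtain K0 where K0: "K0 \<in> \<K>" and K0_min: "\<And>T. T \<in> \<K> \<Longrightarrow> T \<subseteq> K0 \<Longrightarrow> T = K0"
    using minimal_closed_member[OF cK \<open>K \<in> \<K>\<close>] by metis
  have K0K: "K0 \<subseteq> K" using K0 closedin_subset[of ?K K0] by (simp add: \<K>_def)
  \<comment> \<open>Convexity is left out of this second family so that orbit closures belong to
    it.\<close>
  define \<F> where "\<F> = {S. closedin ?K S \<and> S \<noteq> {} \<and> S \<subseteq> K0 \<and> (\<forall>s. \<forall>x\<in>S. act s x \<in> S)}"
  have "K0 \<in> \<F>" using K0 by (simp add: \<F>_def \<K>_def)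
  have "\<Inter>\<C> \<in> \<F>" if C: "\<C> \<subseteq> \<F>" "\<C> \<noteq> {}" "\<Inter>\<C> \<noteq> {}" for \<C>
  proof -
    have "closedin ?K (\<Inter>\<C>)" using C by (intro closedin_Inter) (auto simp: \<F>_def)
    moreover obtain S where "S \<in> \<C>" "S \<in> \<F>" using C by blast
    then have "\<Inter>\<C> \<subseteq> K0" by (auto simp: \<F>_def)
    moreover have "act s x \<in> S" if "x \<in> S" "S \<in> \<C>" for s x S
      using that \<open>\<C> \<subseteq> \<F>\<close> by (auto simp: \<F>_def)
    ultimately show ?thesis using C(3) unfolding \<F>_def by blast
  qed
  moreover have "closedin ?K S" if "S \<in> \<F>" for S using that by (simp add: \<F>_def)
  moreover have "{} \<notin> \<F>" by (simp add: \<F>_def)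
  ultimately obtain F where F: "F \<in> \<F>" and F_min: "\<And>T. T \<in> \<F> \<Longrightarrow> T \<subseteq> F \<Longrightarrow> T = F"
    using minimal_closed_member[OF cK \<open>K0 \<in> \<F>\<close>] by metis
  have F_closed: "closedin ?K F" and F_ne: "F \<noteq> {}" and FK0: "F \<subseteq> K0"
    using F by (auto simp: \<F>_def)
  have F_inv: "act s x \<in> F" if "x \<in> F" for s x
    using F that by (auto simp: \<F>_def)
  have FK: "F \<subseteq> K" using FK0 K0K by blast
  let ?F = "subtopology ?K F"
  have topF: "topspace ?F = F" using FK by auto
  have F_compact: "compactin ?w F"
    using closedin_compact_space[OF cK F_closed] by (simp add: compactin_subtopology)
  have F_eq: "?F = subtopology ?w F" using FK by (simp add: subtopology_subtopology Int_absorb1)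
  have sysF: "continuous_dynamical_system ?F act"
    using FK F_inv by (intro continuous_dynamical_system_subtopology assms(6)) auto
  have cF: "compact_space ?F" using F_compact by (simp add: F_eq compact_space_subtopology)
  obtain \<mu> where \<mu>: "left_invariant_mean (LUC :: ('s \<Rightarrow> complex) set) \<mu>" using assms(1) by blast
  obtain x0 where "x0 \<in> F" using F_ne by blast
  then obtain M where M: "invariant_mean ?F act M"
    using exists_invariant_mean[OF \<mu> sysF cF, of x0] topF by auto
  \<comment> \<open>If the orbit of \<open>x\<close> missed \<open>W\<close>, its closure, invariant
    by continuity of the translations, would be a strictly smaller member of
    \<open>\<F>\<close>.\<close>
  have minimal: "\<exists>s. act s x \<in> W" if x: "x \<in> F" and W: "openin ?F W" "W \<noteq> {}" for x W
  proof (rule ccontr)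
    assume "\<not> ?thesis"
    then have "range (\<lambda>s. act s x) \<subseteq> F - W" using F_inv[OF x] by auto
    moreover have "closedin ?F (F - W)" using closedin_diff[OF closedin_topspace W(1)] topF by simp
    ultimately have sub: "?F closure_of (range (\<lambda>s. act s x)) \<subseteq> F - W"
      by (rule closure_of_minimal)
    have "?F closure_of (range (\<lambda>s. act s x)) \<in> \<F>"
    proof -
      have "closedin ?K (?F closure_of (range (\<lambda>s. act s x)))"
        using closedin_trans_full[OF closedin_closure_of F_closed] .
      moreover have "?F closure_of (range (\<lambda>s. act s x)) \<noteq> {}"
        using closure_of_subset[of "range (\<lambda>s. act s x)" ?F] topF F_inv[OF x] by blast
      moreover have "act s z \<in> ?F closure_of (range (\<lambda>s. act s x))"
        if "z \<in> ?F closure_of (range (\<lambda>s. act s x))" for s z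
      proof -
        have "continuous_map ?F ?F (act s)"
          using sysF by (simp add: continuous_dynamical_system_def dynamical_system_def)
        then have "act s z \<in> ?F closure_of (act s ` range (\<lambda>s. act s x))"
          using continuous_map_image_closure_subset that by blast
        moreover have "act s ` range (\<lambda>s. act s x) \<subseteq> range (\<lambda>s. act s x)"
          using act_act x FK by auto
        ultimately show ?thesis using closure_of_mono by blast
      qed
      ultimately show ?thesis using sub FK0 by (auto simp: \<F>_def)
    qed
    then have "?F closure_of (range (\<lambda>s. act s x)) = F" using sub by (intro F_min) auto
    then show False using sub W openin_subset[OF W(1)] topF by auto
  qed
  have haus: "Hausdorff_space ?F"
    using Hausdorff_weak_topology[OF Q] by (simp add: Hausdorff_space_subtopology)
  interpret minimal_mean ?F act M
  proof
    show "continuous_map ?F ?F (act s)" for s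
      using sysF by (simp add: continuous_dynamical_system_def dynamical_system_def)
  qed (use cF haus M minimal topF in auto)
  have surj: "act s ` F = F" for s using act_surj[of s] by (simp only: topF)
  have nonexp: "p (act s x - act s y) \<le> p (x - y)" if "p \<in> Q" "x \<in> K" "y \<in> K" for p s x y
    using assms(7) that by (simp add: nonexpansive_on_def)
  have zero: "p (a - b) = 0" if pQ: "p \<in> Q" and ab: "a \<in> F" "b \<in> F" for p a b
  proof (rule ccontr)
    assume "p (a - b) \<noteq> 0"
    have p: "seminorm p" using Q pQ by (simp add: topology_determined_by_def)
    then have pos: "0 < p (a - b)" using \<open>p (a - b) \<noteq> 0\<close> seminorm_nonneg[OF p, of "a - b"] by simp
    \<comment> \<open>\<open>finite_net\<close> doubles this bound, and
      \<open>finite_net_normal_structure\<close> asks for a net of radius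
      \<open>p (a - b) / 2\<close>.\<close>
    then have "0 < p (a - b) / 4" by simp
    from weakly_compact_fragmented[OF Q pQ F_compact F_ne this]
    obtain W where W: "openin ?w W" "W \<inter> F \<noteq> {}"
      "\<forall>x\<in>W \<inter> F. \<forall>y\<in>W \<inter> F. p (x - y) \<le> p (a - b) / 4" by blast
    have ball: "closedin ?F {x \<in> topspace ?F. p (x - y) \<le> r}" for y r
    proof -
      have "{x \<in> topspace ?F. p (x - y) \<le> r} = {x. p (x - y) \<le> r} \<inter> F" using topF by auto
      then show ?thesis
        unfolding F_eq closedin_subtopology using closedin_weak_seminorm_le[OF Q pQ] by blast
    qed
    have "openin ?F (W \<inter> F)" unfolding F_eq openin_subtopology using W(1) by blast
    then have "\<exists>N. finite N \<and> N \<subseteq> topspace ?F \<and> (\<forall>x\<in>topspace ?F. \<exists>y\<in>N. p (x - y) \<le> 2 * (p (a - b) / 4))"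
    proof (intro finite_net[of "\<lambda>x y. p (x - y)" "W \<inter> F"])
      show "p (x - x) = 0" for x using seminorm_zero[OF p] by simp
      show "p (x - y) = p (y - x)" for x y by (rule seminorm_commute[OF p])
      show "p (x - z) \<le> p (x - y) + p (y - z)" for x y z by (rule seminorm_triangle[OF p])
      show "closedin ?F {x \<in> topspace ?F. p (x - y) \<le> r}" for y r by (rule ball)
      show "p (act s x - act s y) \<le> p (x - y)" if "x \<in> topspace ?F" "y \<in> topspace ?F" for s x y
        using that by (intro nonexp[OF pQ]) auto
      show "W \<inter> F \<noteq> {}" by (rule W(2))
      show "p (x - y) \<le> p (a - b) / 4" if "x \<in> W \<inter> F" "y \<in> W \<inter> F" for x y
        using W(3) that by blast
    qed
    then obtain N where N: "finite N" "N \<subseteq> F" "\<And>x. x \<in> F \<Longrightarrow> \<exists>y\<in>N. p (x - y) \<le> p (a - b) / 2"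
      using topF by auto
    from finite_net_normal_structure[OF p N ab pos]
    obtain y r where y: "y \<in> convex hull F" "\<forall>x\<in>F. p (y - x) \<le> r"
      and r: "\<exists>x\<in>F. \<exists>x'\<in>F. r < p (x - x')" by blast
    \<comment> \<open>The hull point \<open>y\<close> makes \<open>K1\<close> nonempty. The action
      preserves \<open>K1\<close> because each point of \<open>F\<close> has the form
      \<open>act s x'\<close> with \<open>x'\<close> in \<open>F\<close>, and nonexpansiveness
      compares \<open>act s z\<close> with it.\<close>
    define K1 where "K1 = K0 \<inter> (\<Inter>x\<in>F. {z. p (z - x) \<le> r})"
    have "convex K0" using K0 by (simp add: \<K>_def)
    have "K1 \<in> \<K>"
    proof -
      have "closedin ?w (\<Inter>x\<in>F. {z. p (z - x) \<le> r})"
        using F_ne closedin_weak_seminorm_le[OF Q pQ] by (intro closedin_Inter) auto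
      then have "closedin ?K (K \<inter> (\<Inter>x\<in>F. {z. p (z - x) \<le> r}))"
        unfolding closedin_subtopology by blast
      moreover have "closedin ?K K0" using K0 by (simp add: \<K>_def)
      ultimately have "closedin ?K (K0 \<inter> (K \<inter> (\<Inter>x\<in>F. {z. p (z - x) \<le> r})))"
        by (simp only: closedin_Int)
      moreover have "K1 = K0 \<inter> (K \<inter> (\<Inter>x\<in>F. {z. p (z - x) \<le> r}))"
        using K0K by (auto simp: K1_def)
      ultimately have "closedin ?K K1" by simp
      moreover have "y \<in> K1"
        using y hull_minimal[of F K0 convex] FK0 \<open>convex K0\<close> by (auto simp: K1_def)
      moreover have "convex K1"
        unfolding K1_def using \<open>convex K0\<close> convex_seminorm_ball[OF p]
        by (intro convex_Int convex_INT) auto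
      moreover have "act s z \<in> K1" if z: "z \<in> K1" for s z
      proof -
        have "p (act s z - x) \<le> r" if "x \<in> F" for x
        proof -
          have "x \<in> act s ` F" unfolding surj by (rule that)
          then obtain x' where x': "x' \<in> F" "x = act s x'" by (rule imageE)
          have "p (act s z - x) \<le> p (z - x')"
            unfolding x'(2) using z x'(1) K0K FK by (intro nonexp[OF pQ]) (auto simp: K1_def)
          also have "\<dots> \<le> r" using z x' by (simp add: K1_def)
          finally show ?thesis .
        qed
        then show ?thesis using z K0 by (auto simp: K1_def \<K>_def)
      qed
      ultimately show ?thesis by (auto simp: \<K>_def)
    qed
    then have "K1 = K0" by (rule K0_min) (auto simp: K1_def)
    \<comment> \<open>As \<open>F\<close> lies in \<open>K0 = K1\<close>, the number
      \<open>r\<close> bounds all \<open>p\<close>-distances within \<open>F\<close>, against the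
      choice of \<open>r\<close> below the diameter.\<close>
    then have "p (z - x) \<le> r" if "x \<in> F" "z \<in> F" for x z
      using that FK0 by (auto simp: K1_def)
    then show False using r by (meson not_less)
  qed
  have "act s x0 = x0" for s
    using zero[OF _ F_inv[OF \<open>x0 \<in> F\<close>] \<open>x0 \<in> F\<close>] by (intro seminorms_separate_points[OF Q])
  then show ?thesis using \<open>x0 \<in> F\<close> FK by blast
qed

end
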